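(* Let $\mathbb F$ be a field and let $q\in\mathbb F$ be nonzero and not a root of $1$. Assume that $\mathbb F$ contains a square root of $q$. Pick $\theta\in\mathbb F$ such that $\theta^2=q$ or $\theta^2=q^{-1}$, pick $t\in\mathbb Z$, and use the primary or the secondary identification of type $(\theta,t)$. Define $q^{1/2}=-\theta$ if $\theta^2=q$, and $q^{1/2}=\theta^{-1}$ if $\theta^2=q^{-1}$. Then the operator $$\mathfrak R=\exp_q(n_x)\,\Upsilon\,\exp_q(n_z)$$ acts as a rotator on each finite-dimensional $U_q(\mathfrak{sl}_2)$-module of type 1.
   Context: Notation: $\mathbb N=\{0,1,2,\dots\}$, $[n]_q=(q^n-q^{-n})/(q-q^{-1})$, $[n]^!_q=[n]_q[n-1]_q\cdots[1]_q$, $[0]^!_q=1$. Chevalley presentation: $U_q(\mathfrak{sl}_2)$ is the $\mathbb F$-algebra (associative, unital) with generators $e,f,k^{\pm1}$ and relations $kk^{-1}=k^{-1}k=1$, $ke=q^2ek$, $kf=q^{-2}fk$, $ef-fe=(k-k^{-1})/(q-q^{-1})$. Equitable presentation: $U_q(\mathfrak{sl}_2)$ is isomorphic to the $\mathbb F$-algebra with generators $x,y^{\pm1},z$ and relations $yy^{-1}=y^{-1}y=1$, $\frac{qxy-q^{-1}yx}{q-q^{-1}}=1$, $\frac{qyz-q^{-1}zy}{q-q^{-1}}=1$, $\frac{qzx-q^{-1}xz}{q-q^{-1}}=1$. For $0\neq\theta\in\mathbb F$ and $t\in\mathbb Z$, the primary identification of type $(\theta,t)$ identifies the two algebras via the isomorphism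 $x\mapsto k^{-1}-k^{-1-t}e\,q^{1+t}(q-q^{-1})\theta^{-1}$, $y^{\pm1}\mapsto k^{\pm1}$, $z\mapsto k^{-1}+fk^tq^{-t}(q-q^{-1})\theta$; the secondary identification of type $(\theta,t)$ identifies them via the isomorphism $x\mapsto k-k^{1+t}f\,q^{1+t}(q-q^{-1})\theta^{-1}$, $y^{\pm1}\mapsto k^{\mp1}$, $z\mapsto k+ek^{-t}q^{-t}(q-q^{-1})\theta$. Elements: $n_x=\frac{q(1-yz)}{q-q^{-1}}$, $n_y=\frac{q(1-zx)}{q-q^{-1}}$, $n_z=\frac{q(1-xy)}{q-q^{-1}}$; each acts nilpotently on every finite-dimensional $U_q(\mathfrak{sl}_2)$-module. For a nilpotent linear map $\varphi$ on a finite-dimensional space, $\exp_q(\varphi)=\sum_{i\in\mathbb N}\frac{q^{\binom i2}}{[i]^!_q}\varphi^i$. Type 1 modules: a nonzero finite-dimensional $U_q(\mathfrak{sl}_2)$-module $V$ has type 1 if it is a direct sum of irreducible submodules each isomorphic to some $\mathbf V_d$ ($d\in\mathbb N$), where $\mathbf V_d$ has basis $v_0,\dots,v_d$ with $kv_i=q^{d-2i}v_i$, $fv_i=[i+1]_qv_{i+1}$ ($0\le i\le d-1$), $fv_d=0$, $ev_i=[d-i+1]_qv_{i-1}$ ($1\le i\le d$), $ev_0=0$. (Equivalently, $k$ is diagonalizable on $V$ with all eigenvalues in $\{q^\lambda\}_{\lambda\in\mathbb Z}$.) For $\lambda\in\mathbb Z$, $V(\lambda)=\{v\in V: kv=q^\lambda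 v\}$; $V$ is the direct sum of these weight spaces. The operator $\Upsilon$ acts linearly on each type 1 finite-dimensional module $V$: on $V(\lambda)$ it is $q^{-\lambda^2/2}$ times the identity, where $q^{-\lambda^2/2}=(q^{1/2})^{-\lambda^2}$ and $q^{1/2}$ is the square root of $q$ specified in the claim. A rotator on a finite-dimensional type 1 module $V$ is an invertible $R\in\mathrm{End}(V)$ such that on $V$: $R^{-1}xR=y$, $R^{-1}yR=z$, $R^{-1}zR=x$. *)

theory Defs
  imports HOL.Vector_Spaces "HOL-Algebra.QuotRing" "HOL-Library.Poly_Mapping"
begin

section \<open>Algebras presented by generators and relations\<close>

text \<open>The free monoid on \<open>'g\<close>, written additively because the convolution product of
  \<open>Poly_Mapping\<close> expects an additive monoid of exponents.\<close>

datatype 'g word = Word "'g list"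

instantiation word :: (type) monoid_add
begin

definition zero_word :: "'a word" where "zero_word = Word []"

fun plus_word :: "'a word \<Rightarrow> 'a word \<Rightarrow> 'a word" where
  "plus_word (Word u) (Word v) = Word (u @ v)"

instance
proof
  fix a b c :: "'a word"
  show "a + b + c = a + (b + c)" by (cases a; cases b; cases c) simp
  show "0 + a = a" by (cases a) (simp add: zero_word_def)
  show "a + 0 = a" by (cases a) (simp add: zero_word_def)
qed

end

text \<open>The free associative unital algebra is the monoid algebra of the free monoid.\<close>

type_synonym ('g, 'f) free_alg = "'g word \<Rightarrow>\<^sub>0 'f"

definition free_gen :: "'g \<Rightarrow> ('g, 'f::field) free_alg" where
  "free_gen g = Poly_Mapping.single (Word [g]) 1"

definition free_scalar :: "'f::field \<Rightarrow> ('g, 'f) free_alg" where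
  "free_scalar c = Poly_Mapping.single 0 c"

definition free_ring :: "('g, 'f::field) free_alg ring" where
  "free_ring = \<lparr>carrier = UNIV, mult = (*), one = 1, zero = 0, add = (+)\<rparr>"

definition presented_alg :: "('g, 'f::field) free_alg set \<Rightarrow> ('g, 'f) free_alg set ring" where
  "presented_alg rels = free_ring Quot (Idl\<^bsub>free_ring\<^esub> rels)"

definition presented_class ::
  "('g, 'f::field) free_alg set \<Rightarrow> ('g, 'f) free_alg \<Rightarrow> ('g, 'f) free_alg set" where
  "presented_class rels a = (Idl\<^bsub>free_ring\<^esub> rels) +>\<^bsub>free_ring\<^esub> a"


section \<open>The algebra $U_q(\mathfrak{sl}_2)$\<close>

datatype uq_gen = GE | GF | GK | GKinv

definition uq_relations :: "'f::field \<Rightarrow> (uq_gen, 'f) free_alg set" where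
  "uq_relations q =
    (let e = free_gen GE; f = free_gen GF; k = free_gen GK; ki = free_gen GKinv
     in {k * ki - 1,
         ki * k - 1,
         k * e - free_scalar (q^2) * e * k,
         k * f - free_scalar (inverse q ^ 2) * f * k,
         e * f - f * e - free_scalar (inverse (q - inverse q)) * (k - ki)})"

type_synonym 'f uq = "(uq_gen, 'f) free_alg set"

definition Uq :: "'f::field \<Rightarrow> 'f uq ring" where
  "Uq q = presented_alg (uq_relations q)"

definition uq_scalar :: "'f::field \<Rightarrow> 'f \<Rightarrow> 'f uq" where
  "uq_scalar q c = presented_class (uq_relations q) (free_scalar c)"

definition uq_e :: "'f::field \<Rightarrow> 'f uq" where
  "uq_e q = presented_class (uq_relations q) (free_gen GE)"

definition uq_f :: "'f::field \<Rightarrow> 'f uq" where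
  "uq_f q = presented_class (uq_relations q) (free_gen GF)"

definition uq_k :: "'f::field \<Rightarrow> 'f uq" where
  "uq_k q = presented_class (uq_relations q) (free_gen GK)"

text \<open>Integer powers of \<open>k\<close>. The inverse used by \<open>[^]\<close> for negative exponents is the
  inverse in the ring \<open>Uq q\<close>, that is, the class of the generator \<open>GKinv\<close>.\<close>

definition uq_kpow :: "'f::field \<Rightarrow> int \<Rightarrow> 'f uq" where
  "uq_kpow q m = uq_k q [^]\<^bsub>Uq q\<^esub> m"


section \<open>Equitable generators\<close>

datatype identification = Primary | Secondary

text \<open>The images in the Chevalley presentation of the equitable generators \<open>x\<close>, \<open>y\<close>, \<open>z\<close>
  under the identification of type \<open>(\<theta>, t)\<close>.\<close>

fun eq_x :: "identification \<Rightarrow> 'f::field \<Rightarrow> 'f \<Rightarrow> int \<Rightarrow> 'f uq" where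
  "eq_x Primary q \<theta> t =
     uq_kpow q (- 1) \<ominus>\<^bsub>Uq q\<^esub>
       (uq_kpow q (- 1 - t) \<otimes>\<^bsub>Uq q\<^esub> uq_e q \<otimes>\<^bsub>Uq q\<^esub>
         uq_scalar q (q powi (1 + t) * (q - inverse q) * inverse \<theta>))"
| "eq_x Secondary q \<theta> t =
     uq_k q \<ominus>\<^bsub>Uq q\<^esub>
       (uq_kpow q (1 + t) \<otimes>\<^bsub>Uq q\<^esub> uq_f q \<otimes>\<^bsub>Uq q\<^esub>
         uq_scalar q (q powi (1 + t) * (q - inverse q) * inverse \<theta>))"

fun eq_y :: "identification \<Rightarrow> 'f::field \<Rightarrow> 'f \<Rightarrow> int \<Rightarrow> 'f uq" where
  "eq_y Primary q \<theta> t = uq_k q"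
| "eq_y Secondary q \<theta> t = uq_kpow q (- 1)"

fun eq_z :: "identification \<Rightarrow> 'f::field \<Rightarrow> 'f \<Rightarrow> int \<Rightarrow> 'f uq" where
  "eq_z Primary q \<theta> t =
     uq_kpow q (- 1) \<oplus>\<^bsub>Uq q\<^esub>
       (uq_f q \<otimes>\<^bsub>Uq q\<^esub> uq_kpow q t \<otimes>\<^bsub>Uq q\<^esub>
         uq_scalar q (q powi (- t) * (q - inverse q) * \<theta>))"
| "eq_z Secondary q \<theta> t =
     uq_k q \<oplus>\<^bsub>Uq q\<^esub>
       (uq_e q \<otimes>\<^bsub>Uq q\<^esub> uq_kpow q (- t) \<otimes>\<^bsub>Uq q\<^esub>
         uq_scalar q (q powi (- t) * (q - inverse q) * \<theta>))"

definition uq_nx :: "identification \<Rightarrow> 'f::field \<Rightarrow> 'f \<Rightarrow> int \<Rightarrow> 'f uq" where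
  "uq_nx idt q \<theta> t =
     uq_scalar q (q / (q - inverse q)) \<otimes>\<^bsub>Uq q\<^esub>
       (\<one>\<^bsub>Uq q\<^esub> \<ominus>\<^bsub>Uq q\<^esub> (eq_y idt q \<theta> t \<otimes>\<^bsub>Uq q\<^esub> eq_z idt q \<theta> t))"

definition uq_nz :: "identification \<Rightarrow> 'f::field \<Rightarrow> 'f \<Rightarrow> int \<Rightarrow> 'f uq" where
  "uq_nz idt q \<theta> t =
     uq_scalar q (q / (q - inverse q)) \<otimes>\<^bsub>Uq q\<^esub>
       (\<one>\<^bsub>Uq q\<^esub> \<ominus>\<^bsub>Uq q\<^esub> (eq_x idt q \<theta> t \<otimes>\<^bsub>Uq q\<^esub> eq_y idt q \<theta> t))"


section \<open>Modules\<close>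

definition q_int :: "'f::field \<Rightarrow> nat \<Rightarrow> 'f" where
  "q_int q n = (q ^ n - inverse q ^ n) / (q - inverse q)"

definition q_fact :: "'f::field \<Rightarrow> nat \<Rightarrow> 'f" where
  "q_fact q n = (\<Prod>i=1..n. q_int q i)"

text \<open>A left module: \<open>\<rho>\<close> is a homomorphism of unital algebras from \<open>Uq q\<close> to the linear
  endomorphisms of the vector space \<open>'v\<close>; its values outside the carrier are irrelevant.\<close>

definition uq_module ::
  "('f::field \<Rightarrow> 'v::ab_group_add \<Rightarrow> 'v) \<Rightarrow> 'f \<Rightarrow> ('f uq \<Rightarrow> 'v \<Rightarrow> 'v) \<Rightarrow> bool" where
  "uq_module scale q \<rho> \<longleftrightarrow>
     vector_space scale \<and>
     (\<forall>a\<in>carrier (Uq q). Vector_Spaces.linear scale scale (\<rho> a)) \<and>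
     (\<forall>a\<in>carrier (Uq q). \<forall>b\<in>carrier (Uq q). \<forall>v.
        \<rho> (a \<oplus>\<^bsub>Uq q\<^esub> b) v = \<rho> a v + \<rho> b v \<and>
        \<rho> (a \<otimes>\<^bsub>Uq q\<^esub> b) v = \<rho> a (\<rho> b v)) \<and>
     (\<forall>c v. \<rho> (uq_scalar q c) v = scale c v) \<and>
     (\<forall>v. \<rho> \<one>\<^bsub>Uq q\<^esub> v = v)"

definition finite_dim :: "('f::field \<Rightarrow> 'v::ab_group_add \<Rightarrow> 'v) \<Rightarrow> bool" where
  "finite_dim scale \<longleftrightarrow> (\<exists>B. finite B \<and> module.span scale B = UNIV)"

definition uq_submodule ::
  "('f::field \<Rightarrow> 'v::ab_group_add \<Rightarrow> 'v) \<Rightarrow> 'f \<Rightarrow> ('f uq \<Rightarrow> 'v \<Rightarrow> 'v) \<Rightarrow> 'v set \<Rightarrow> bool" where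
  "uq_submodule scale q \<rho> W \<longleftrightarrow>
     module.subspace scale W \<and> (\<forall>a\<in>carrier (Uq q). \<rho> a ` W \<subseteq> W)"

definition uq_irreducible ::
  "('f::field \<Rightarrow> 'v::ab_group_add \<Rightarrow> 'v) \<Rightarrow> 'f \<Rightarrow> ('f uq \<Rightarrow> 'v \<Rightarrow> 'v) \<Rightarrow> 'v set \<Rightarrow> bool" where
  "uq_irreducible scale q \<rho> W \<longleftrightarrow>
     uq_submodule scale q \<rho> W \<and> W \<noteq> {0} \<and>
     (\<forall>W'. uq_submodule scale q \<rho> W' \<and> W' \<subseteq> W \<longrightarrow> W' = {0} \<or> W' = W)"

text \<open>The submodule \<open>W\<close> is isomorphic to $\mathbf V_d$: it has a basis \<open>v 0, \<dots>, v d\<close> on which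
  \<open>k\<close>, \<open>f\<close>, \<open>e\<close> act by the formulas that define $\mathbf V_d$.\<close>

definition is_copy_of_Vd ::
  "('f::field \<Rightarrow> 'v::ab_group_add \<Rightarrow> 'v) \<Rightarrow> 'f \<Rightarrow> ('f uq \<Rightarrow> 'v \<Rightarrow> 'v) \<Rightarrow> nat \<Rightarrow> 'v set \<Rightarrow> bool" where
  "is_copy_of_Vd scale q \<rho> d W \<longleftrightarrow>
     uq_submodule scale q \<rho> W \<and>
     (\<exists>v. inj_on v {0..d} \<and> \<not> module.dependent scale (v ` {0..d}) \<and>
          module.span scale (v ` {0..d}) = W \<and>
          (\<forall>i\<le>d. \<rho> (uq_k q) (v i) = scale (q powi (int d - 2 * int i)) (v i)) \<and>
          (\<forall>i<d. \<rho> (uq_f q) (v i) = scale (q_int q (i + 1)) (v (i + 1))) \<and>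
          \<rho> (uq_f q) (v d) = 0 \<and>
          (\<forall>i\<in>{1..d}. \<rho> (uq_e q) (v i) = scale (q_int q (d - i + 1)) (v (i - 1))) \<and>
          \<rho> (uq_e q) (v 0) = 0)"

definition type1 ::
  "('f::field \<Rightarrow> 'v::ab_group_add \<Rightarrow> 'v) \<Rightarrow> 'f \<Rightarrow> ('f uq \<Rightarrow> 'v \<Rightarrow> 'v) \<Rightarrow> bool" where
  "type1 scale q \<rho> \<longleftrightarrow>
     (\<exists>u::'v. u \<noteq> 0) \<and>
     (\<exists>(n::nat) W.
        (\<forall>i<n. uq_irreducible scale q \<rho> (W i) \<and> (\<exists>d. is_copy_of_Vd scale q \<rho> d (W i))) \<and>
        (\<forall>v. \<exists>!w. w \<in> (\<Pi>\<^sub>E i\<in>{..<n}. W i) \<and> v = (\<Sum>i<n. w i)))"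

definition weight_space ::
  "('f::field \<Rightarrow> 'v::ab_group_add \<Rightarrow> 'v) \<Rightarrow> 'f \<Rightarrow> ('f uq \<Rightarrow> 'v \<Rightarrow> 'v) \<Rightarrow> int \<Rightarrow> 'v set" where
  "weight_space scale q \<rho> \<mu> = {v. \<rho> (uq_k q) v = scale (q powi \<mu>) v}"


section \<open>The operators\<close>

text \<open>\<open>Sum_any\<close> adds the finitely many nonzero terms of the series; it agrees with the sum over
  all \<open>i\<close> because \<open>\<phi>\<close> is nilpotent wherever \<open>exp_q\<close> is used.\<close>

definition exp_q ::
  "('f::field \<Rightarrow> 'v::ab_group_add \<Rightarrow> 'v) \<Rightarrow> 'f \<Rightarrow> ('v \<Rightarrow> 'v) \<Rightarrow> 'v \<Rightarrow> 'v" where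
  "exp_q scale q \<phi> v =
     Sum_any (\<lambda>i::nat. scale (q ^ (i choose 2) / q_fact q i) ((\<phi> ^^ i) v))"

definition sqrt_q :: "'f::field \<Rightarrow> 'f \<Rightarrow> 'f" where
  "sqrt_q q \<theta> = (if \<theta>^2 = q then - \<theta> else inverse \<theta>)"

text \<open>The parameter \<open>s\<close> is the chosen square root of \<open>q\<close>. On a module of type 1 the operator exists
  and is unique because the module is the direct sum of its weight spaces.\<close>

definition Upsilon ::
  "('f::field \<Rightarrow> 'v::ab_group_add \<Rightarrow> 'v) \<Rightarrow> 'f \<Rightarrow> ('f uq \<Rightarrow> 'v \<Rightarrow> 'v) \<Rightarrow> 'f \<Rightarrow> 'v \<Rightarrow> 'v" where
  "Upsilon scale q \<rho> s =
     (THE T. Vector_Spaces.linear scale scale T \<and>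
             (\<forall>\<mu>. \<forall>v\<in>weight_space scale q \<rho> \<mu>. T v = scale (s powi (- (\<mu>^2))) v))"

definition rotator_op ::
  "('f::field \<Rightarrow> 'v::ab_group_add \<Rightarrow> 'v) \<Rightarrow> 'f \<Rightarrow> ('f uq \<Rightarrow> 'v \<Rightarrow> 'v) \<Rightarrow>
    identification \<Rightarrow> 'f \<Rightarrow> int \<Rightarrow> 'v \<Rightarrow> 'v" where
  "rotator_op scale q \<rho> idt \<theta> t =
     exp_q scale q (\<rho> (uq_nx idt q \<theta> t)) \<circ> Upsilon scale q \<rho> (sqrt_q q \<theta>) \<circ>
     exp_q scale q (\<rho> (uq_nz idt q \<theta> t))"

definition is_rotator ::
  "('f::field \<Rightarrow> 'v::ab_group_add \<Rightarrow> 'v) \<Rightarrow> 'f \<Rightarrow> ('f uq \<Rightarrow> 'v \<Rightarrow> 'v) \<Rightarrow>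
    identification \<Rightarrow> 'f \<Rightarrow> int \<Rightarrow> ('v \<Rightarrow> 'v) \<Rightarrow> bool" where
  "is_rotator scale q \<rho> idt \<theta> t R \<longleftrightarrow>
     Vector_Spaces.linear scale scale R \<and> bij R \<and>
     inv_into UNIV R \<circ> \<rho> (eq_x idt q \<theta> t) \<circ> R = \<rho> (eq_y idt q \<theta> t) \<and>
     inv_into UNIV R \<circ> \<rho> (eq_y idt q \<theta> t) \<circ> R = \<rho> (eq_z idt q \<theta> t) \<and>
     inv_into UNIV R \<circ> \<rho> (eq_z idt q \<theta> t) \<circ> R = \<rho> (eq_x idt q \<theta> t)"

end

theory Submission
  imports Defs "HOL-Computational_Algebra.Formal_Power_Series"
begin

text \<open>Put \<open>R = exp\<^sub>q(n\<^sub>x) \<Upsilon> exp\<^sub>q(n\<^sub>z)\<close>. The claim amounts to \<open>R\<close> being invertible together with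
  \<open>x R = R y\<close>, \<open>y R = R z\<close> and \<open>z R = R x\<close>, and each of these identities follows by moving a generator
  through the three factors of \<open>R\<close>, one at a time.

  Passing \<open>E = exp\<^sub>q(n\<^sub>z)\<close>. Since \<open>n\<^sub>z y = q\<^sup>-\<^sup>2 y n\<^sub>z\<close> and \<open>x y = 1 - (1 - q\<^sup>-\<^sup>2) n\<^sub>z\<close>, the functional equation
  \<open>exp\<^sub>q(\<phi>) = (1 - (q\<^sup>2 - 1) \<phi>) exp\<^sub>q(q\<^sup>2 \<phi>)\<close> turns into \<open>E y = y x y E\<close> and \<open>E x = y\<^sup>-\<^sup>1 E\<close>. For \<open>z\<close> one
  commutes it with the powers of \<open>n\<^sub>z\<close>, starting from \<open>n\<^sub>z z - z n\<^sub>z = y - x\<close>; after summation the result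
  telescopes to \<open>E z = (z + y - y\<^sup>-\<^sup>1) E\<close> (lemmas \<open>E_Y\<close>, \<open>E_X\<close>, \<open>E_Z\<close>).

  Passing \<open>F = exp\<^sub>q(n\<^sub>x)\<close>. The equitable relations survive the exchange of \<open>x\<close> and \<open>z\<close> together with
  \<open>q \<mapsto> q\<^sup>-\<^sup>1\<close>, which sends \<open>n\<^sub>z\<close> to \<open>- n\<^sub>x\<close>. As \<open>exp\<close> with parameter \<open>q\<^sup>-\<^sup>1\<close> of \<open>- n\<^sub>x\<close> is the inverse of \<open>F\<close>,
  the three identities for \<open>E\<close> yield \<open>z F = F y\<^sup>-\<^sup>1\<close>, \<open>x F = F (x + y - y\<^sup>-\<^sup>1)\<close> and \<open>y F = F y z y\<close>
  (lemmas \<open>Z_F\<close>, \<open>X_F\<close>, \<open>Y_F\<close>).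

  Passing \<open>\<Upsilon>\<close>. On a vector of weight \<open>\<mu>\<close> the operator \<open>\<Upsilon>\<close> is a Gaussian in \<open>\<mu>\<close>, while \<open>n\<^sub>z\<close> and \<open>n\<^sub>x\<close> shift
  \<open>\<mu>\<close> by \<open>2\<close> and \<open>-2\<close>. Completing squares gives \<open>\<Upsilon> y n\<^sub>z = n\<^sub>z y\<^sup>-\<^sup>1 \<Upsilon>\<close> and \<open>\<Upsilon> y\<^sup>-\<^sup>1 n\<^sub>x = n\<^sub>x y \<Upsilon>\<close>
  (lemmas \<open>T_Y_nz\<close>, \<open>T_Yi_nx\<close>), which is what makes the two sides meet.

  All of this concerns operators on a space spanned by finitely many eigenvectors of \<open>y\<close> whose
  eigenvalues are integer powers of \<open>q\<close>: these weight vectors provide the nilpotency of \<open>n\<^sub>x\<close> and \<open>n\<^sub>z\<close>, the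
  existence and uniqueness of \<open>\<Upsilon>\<close>, and a place where identities of operators can be checked. A module of
  type 1 is such a space. That the images of \<open>x\<close>, \<open>y\<close>, \<open>z\<close> under the primary identification satisfy
  the equitable relations is likewise checked on weight vectors, and the secondary identification is the
  primary one preceded by the Chevalley involution \<open>e \<leftrightarrow> f\<close>, \<open>k \<leftrightarrow> k\<^sup>-\<^sup>1\<close>, which preserves the squares
  \<open>\<mu>\<^sup>2\<close> that define \<open>\<Upsilon>\<close>.\<close>

unbundle fps_syntax

section \<open>The $q$-exponential as a formal power series\<close>

definition exp_q_fps :: "'f::field \<Rightarrow> 'f fps" where
  "exp_q_fps q = Abs_fps (\<lambda>i. q ^ (i choose 2) / q_fact q i)"

text \<open>The series obtained from \<open>p\<close> by substituting \<open>c\<close> times the variable.\<close>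

definition fps_dilate :: "'f::field \<Rightarrow> 'f fps \<Rightarrow> 'f fps" where
  "fps_dilate c p = Abs_fps (\<lambda>i. c ^ i * p $ i)"

lemma fps_dilate_nth [simp]: "fps_dilate c p $ i = c ^ i * p $ i"
  by (simp add: fps_dilate_def)

lemma fps_dilate_mult: "fps_dilate c (p * r) = fps_dilate c p * fps_dilate c r"
proof (rule fps_ext)
  fix n
  have "c ^ n * (p $ i * r $ (n - i)) = (c ^ i * p $ i) * (c ^ (n - i) * r $ (n - i))"
    if "i \<in> {0..n}" for i
  proof -
    have "c ^ n = c ^ i * c ^ (n - i)"
      using that by (simp add: power_add [symmetric])
    then show ?thesis by simp
  qed
  then show "fps_dilate c (p * r) $ n = (fps_dilate c p * fps_dilate c r) $ n"
    by (simp only: fps_dilate_nth fps_mult_nth sum_distrib_left cong: sum.cong)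
qed

lemma fps_dilate_dilate: "fps_dilate c (fps_dilate d p) = fps_dilate (c * d) p"
  by (rule fps_ext) (simp add: power_mult_distrib mult.assoc)

lemma fps_dilate_1 [simp]: "fps_dilate 1 p = p"
  by (rule fps_ext) simp

locale not_root_of_unity =
  fixes q :: "'f::field"
  assumes q_nonzero: "q \<noteq> 0"
    and q_power_neq_1: "n \<ge> 1 \<Longrightarrow> q ^ n \<noteq> 1"
begin

lemma q_powi_eq_1_iff: "q powi m = 1 \<longleftrightarrow> m = 0"
proof
  assume *: "q powi m = 1"
  show "m = 0"
  proof (rule ccontr)
    assume "m \<noteq> 0"
    then have "nat \<bar>m\<bar> \<ge> 1" by simp
    moreover have "q ^ nat \<bar>m\<bar> = 1"
      using * by (auto simp: power_int_def abs_if power_inverse split: if_splits)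
    ultimately show False using q_power_neq_1 by blast
  qed
qed simp

lemma q_powi_eq_iff: "q powi a = q powi b \<longleftrightarrow> a = b"
proof -
  have "q powi a = q powi b \<longleftrightarrow> q powi (a - b) = 1"
    using q_nonzero by (simp add: power_int_diff)
  then show ?thesis by (simp add: q_powi_eq_1_iff)
qed

lemma q_minus_inverse_neq_0: "q - inverse q \<noteq> 0"
proof
  assume "q - inverse q = 0"
  then have "q ^ 2 = 1" using q_nonzero by (simp add: power2_eq_square field_simps)
  then show False using q_power_neq_1 [of 2] by simp
qed

lemma q_int_neq_0: "n \<ge> 1 \<Longrightarrow> q_int q n \<noteq> 0"
proof
  assume "n \<ge> 1" and "q_int q n = 0"
  then have "q ^ n = inverse q ^ n"
    using q_minus_inverse_neq_0 by (simp add: q_int_def)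
  then have "q ^ n * q ^ n = 1"
    using q_nonzero by (metis power_inverse power_not_zero right_inverse)
  then have "q ^ (n + n) = 1"
    by (simp add: power_add)
  with \<open>n \<ge> 1\<close> show False using q_power_neq_1 [of "n + n"] by simp
qed

lemma q_fact_neq_0: "q_fact q n \<noteq> 0"
  by (auto simp: q_fact_def q_int_neq_0)

lemma not_root_of_unity_inverse: "not_root_of_unity (inverse q)"
  by unfold_locales (use q_nonzero q_power_neq_1 in \<open>simp_all add: power_inverse\<close>)

text \<open>The quotient of consecutive coefficients is \<open>q\<^sup>n / [n + 1]\<^sub>q\<close>, and
  \<open>q\<^sup>2\<^sup>m - 1 = q\<^sup>m (q - q\<^sup>-\<^sup>1) [m]\<^sub>q\<close>. In this denominator-free form the recursion serves both the
  functional equation and the telescoping in \<open>E_Z\<close>.\<close>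

lemma exp_q_fps_nth_Suc:
  "exp_q_fps q $ Suc n * (q ^ (2 * Suc n) - 1) = exp_q_fps q $ n * q ^ (2 * n) * (q ^ 2 - 1)"
proof -
  let ?a = "exp_q_fps q" and ?m = "Suc n"
  have "?a $ ?m * q_int q ?m = ?a $ n * q ^ n"
    using q_fact_neq_0 [of n] q_int_neq_0 [of ?m]
    by (simp add: exp_q_fps_def q_fact_def numeral_2_eq_2 power_add field_simps)
  moreover have "q ^ (2 * ?m) - 1 = q_int q ?m * (q ^ ?m * (q - inverse q))"
  proof -
    have "q_int q ?m * (q - inverse q) = q ^ ?m - inverse q ^ ?m"
      using q_minus_inverse_neq_0 by (simp add: q_int_def)
    moreover have "inverse q ^ ?m * q ^ ?m = 1"
      using left_inverse [OF q_nonzero] by (simp only: power_mult_distrib [symmetric] power_one)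
    moreover have "q_int q ?m * (q ^ ?m * (q - inverse q)) = q_int q ?m * (q - inverse q) * q ^ ?m"
      by (simp only: ac_simps)
    ultimately show ?thesis
      by (simp only: left_diff_distrib mult_2 power_add)
  qed
  moreover have "q ^ 2 - 1 = q * (q - inverse q)"
    using q_nonzero by (simp add: power2_eq_square right_diff_distrib)
  moreover have "q ^ (2 * n) = q ^ n * q ^ n"
    by (simp add: mult_2 power_add)
  ultimately show ?thesis
    by simp
qed

text \<open>The functional equation \<open>exp\<^sub>q(\<phi>) = (1 - (q\<^sup>2 - 1) \<phi>) exp\<^sub>q(q\<^sup>2 \<phi>)\<close>: compare coefficients and
  use the recursion.\<close>

lemma exp_q_fps_dilate:
  "exp_q_fps q = (1 - fps_const (q ^ 2 - 1) * fps_X) * fps_dilate (q ^ 2) (exp_q_fps q)"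
proof (rule fps_ext)
  fix n
  show "exp_q_fps q $ n = ((1 - fps_const (q ^ 2 - 1) * fps_X) * fps_dilate (q ^ 2) (exp_q_fps q)) $ n"
  proof (cases n)
    case (Suc m)
    then show ?thesis
      using exp_q_fps_nth_Suc [of m]
      by (simp add: left_diff_distrib mult.assoc fps_mult_left_const_nth power_mult [symmetric]
          power_add mult_2_right power2_eq_square algebra_simps)
  qed (simp add: left_diff_distrib mult.assoc)
qed

text \<open>By the functional equations for \<open>q\<close> and \<open>q\<^sup>-\<^sup>1\<close> the product is unchanged when the variable is
  multiplied by \<open>q\<^sup>2\<close>. As \<open>q\<close> is not a root of unity, such a series is constant. This replaces the
  \<open>q\<close>-binomial theorem.\<close>

lemma exp_q_fps_inverse: "exp_q_fps q * fps_dilate (- 1) (exp_q_fps (inverse q)) = 1"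
proof -
  interpret inv: not_root_of_unity "inverse q"
    by (rule not_root_of_unity_inverse)
  let ?E = "exp_q_fps q" and ?F = "fps_dilate (- 1) (exp_q_fps (inverse q))"
    and ?L = "1 - fps_const (q ^ 2 - 1) * fps_X"
  \<comment> \<open>This is the functional equation for the parameter \<open>q\<^sup>-\<^sup>1\<close>, dilated by \<open>- q\<^sup>2\<close>.\<close>
  have F: "fps_dilate (q ^ 2) ?F = ?L * ?F"
  proof -
    have "exp_q_fps (inverse q) = (1 - fps_const (inverse q ^ 2 - 1) * fps_X) *
        fps_dilate (inverse q ^ 2) (exp_q_fps (inverse q))"
      by (rule inv.exp_q_fps_dilate)
    then have "fps_dilate (- (q ^ 2)) (exp_q_fps (inverse q)) =
      fps_dilate (- (q ^ 2)) (1 - fps_const (inverse q ^ 2 - 1) * fps_X) *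
      fps_dilate (- (q ^ 2)) (fps_dilate (inverse q ^ 2) (exp_q_fps (inverse q)))"
      by (metis fps_dilate_mult)
    moreover have "fps_dilate (- (q ^ 2)) (1 - fps_const (inverse q ^ 2 - 1) * fps_X) = ?L"
      using q_nonzero by (intro fps_ext) (auto simp: algebra_simps power_inverse fps_X_def)
    moreover have "- (q ^ 2) * inverse q ^ 2 = - 1"
      using q_nonzero by (simp add: power_inverse)
    ultimately show ?thesis
      by (simp add: fps_dilate_dilate)
  qed
  have "fps_dilate (q ^ 2) (?E * ?F) = fps_dilate (q ^ 2) ?E * (?L * ?F)"
    by (simp add: fps_dilate_mult F)
  also have "\<dots> = (?L * fps_dilate (q ^ 2) ?E) * ?F"
    by (simp add: ac_simps)
  also have "\<dots> = ?E * ?F"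
    by (simp only: exp_q_fps_dilate [symmetric])
  finally have dil: "fps_dilate (q ^ 2) (?E * ?F) = ?E * ?F" .
  show ?thesis
  proof (rule fps_ext)
    fix n
    show "(?E * ?F) $ n = 1 $ n"
    proof (cases "n = 0")
      case True
      then show ?thesis by (simp add: exp_q_fps_def q_fact_def numeral_2_eq_2)
    next
      case False
      have "(q ^ 2) ^ n * (?E * ?F) $ n = (?E * ?F) $ n"
        by (subst (2) dil [symmetric]) simp
      moreover have "(q ^ 2) ^ n \<noteq> 1"
        using q_power_neq_1 [of "2 * n"] False by (simp add: power_mult)
      ultimately show ?thesis using False by simp
    qed
  qed
qed

end

section \<open>Power series in a nilpotent operator\<close>

text \<open>Evaluation of a power series at an operator, with the same convention for infinite sums as
  \<open>exp_q\<close>, so that \<open>exp_q\<close> is an instance.\<close>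

definition fps_eval ::
  "('f::field \<Rightarrow> 'v::ab_group_add \<Rightarrow> 'v) \<Rightarrow> 'f fps \<Rightarrow> ('v \<Rightarrow> 'v) \<Rightarrow> 'v \<Rightarrow> 'v" where
  "fps_eval scale p \<phi> v = Sum_any (\<lambda>i. scale (p $ i) ((\<phi> ^^ i) v))"

lemma exp_q_eq_fps_eval: "exp_q scale q \<phi> = fps_eval scale (exp_q_fps q) \<phi>"
  by (rule ext) (simp add: exp_q_def fps_eval_def exp_q_fps_def)

lemma (in vector_space) linear_operatorI:
  assumes "\<And>u v. T (u + v) = T u + T v" and "\<And>c v. T (scale c v) = scale c (T v)"
  shows "Vector_Spaces.linear scale scale T"
  by (simp add: Vector_Spaces.linear_iff vector_space_axioms assms)

lemma (in vector_space) linear_funpow: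
  assumes "Vector_Spaces.linear scale scale \<phi>"
  shows "Vector_Spaces.linear scale scale (\<phi> ^^ i)"
proof (induction i)
  case (Suc i)
  then show ?case
    unfolding funpow.simps using assms by (rule Vector_Spaces.linear_compose)
qed (rule linear_operatorI; simp)

locale nilpotent_operator = vector_space scale
  for scale :: "'f::field \<Rightarrow> 'v::ab_group_add \<Rightarrow> 'v" +
  fixes \<phi> :: "'v \<Rightarrow> 'v" and N :: nat
  assumes linear_op: "Vector_Spaces.linear scale scale \<phi>"
    and nilpotent: "(\<phi> ^^ N) v = 0"
begin

sublocale pow: Vector_Spaces.linear scale scale "\<phi> ^^ i" for i
  by (rule linear_funpow [OF linear_op])

lemma funpow_eq_0: "N \<le> i \<Longrightarrow> (\<phi> ^^ i) v = 0"
  by (metis nilpotent comp_apply funpow_add le_add_diff_inverse2 pow.zero)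

lemma fps_eval_eq_sum:
  assumes "N \<le> M"
  shows "fps_eval scale p \<phi> v = (\<Sum>i<M. scale (p $ i) ((\<phi> ^^ i) v))"
  unfolding fps_eval_def
proof (rule Sum_any.expand_superset)
  show "{i. scale (p $ i) ((\<phi> ^^ i) v) \<noteq> 0} \<subseteq> {..<M}"
    using assms funpow_eq_0 by (force simp: not_le [symmetric])
qed simp

lemma linear_fps_eval: "Vector_Spaces.linear scale scale (fps_eval scale p \<phi>)"
proof -
  have "fps_eval scale p \<phi> = (\<lambda>v. \<Sum>i<N. scale (p $ i) ((\<phi> ^^ i) v))"
    by (rule ext) (simp add: fps_eval_eq_sum)
  then show ?thesis
    by (auto intro!: linear_operatorI simp: pow.add pow.scale sum.distrib scale_right_distrib
        scale_sum_right mult.commute)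
qed

lemma fps_eval_1: "fps_eval scale 1 \<phi> v = v"
proof -
  have "fps_eval scale 1 \<phi> v = (\<Sum>i<Suc N. scale (1 $ i) ((\<phi> ^^ i) v))"
    by (rule fps_eval_eq_sum) simp
  then show ?thesis
    by (simp add: sum.lessThan_Suc_shift del: sum.lessThan_Suc)
qed

text \<open>Evaluation is multiplicative, so identities between power series become identities between
  operators. The finite square of indices may be exchanged for a triangle because the difference consists of
  exponents at which the power of \<open>\<phi>\<close> vanishes.\<close>

lemma fps_eval_mult: "fps_eval scale (p * r) \<phi> v = fps_eval scale p \<phi> (fps_eval scale r \<phi> v)"
proof -
  let ?g = "\<lambda>i j. scale (p $ i * r $ j) ((\<phi> ^^ (i + j)) v)"
  have "fps_eval scale p \<phi> (fps_eval scale r \<phi> v) = (\<Sum>i<N. \<Sum>j<N. ?g i j)"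
    by (simp add: fps_eval_eq_sum [OF order_refl] pow.sum pow.scale scale_sum_right funpow_add)
  also have "\<dots> = (\<Sum>(i, j)\<in>{..<N} \<times> {..<N}. ?g i j)"
    by (simp add: sum.cartesian_product)
  also have "\<dots> = (\<Sum>(i, j)\<in>{(i, j). i + j < N + N}. ?g i j)"
  proof (rule sum.mono_neutral_left)
    have "{(i, j). i + j < N + N} \<subseteq> {..<N + N} \<times> {..<N + N}"
      by auto
    then show "finite {(i, j). i + j < N + N}"
      by (rule finite_subset) simp
    show "\<forall>x\<in>{(i, j). i + j < N + N} - {..<N} \<times> {..<N}. (case x of (i, j) \<Rightarrow> ?g i j) = 0"
      by (auto, (metis funpow_eq_0 not_less trans_le_add1 trans_le_add2)+)
  qed auto
  also have "\<dots> = (\<Sum>k<N + N. \<Sum>i\<le>k. ?g i (k - i))"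
    by (rule sum.triangle_reindex)
  also have "\<dots> = fps_eval scale (p * r) \<phi> v"
    by (simp add: fps_eval_eq_sum [of "N + N"] fps_mult_nth scale_sum_left atLeast0AtMost)
  finally show ?thesis ..
qed

lemma fps_eval_linear_factor:
  "fps_eval scale (1 - fps_const c * fps_X) \<phi> v = v - scale c (\<phi> v)"
proof -
  have "fps_eval scale (1 - fps_const c * fps_X) \<phi> v =
      (\<Sum>i<Suc (Suc N). scale ((1 - fps_const c * fps_X) $ i) ((\<phi> ^^ i) v))"
    by (rule fps_eval_eq_sum) simp
  then show ?thesis
    by (simp add: sum.lessThan_Suc_shift del: sum.lessThan_Suc)
qed

lemma fps_eval_dilate: "fps_eval scale (fps_dilate c p) \<phi> = fps_eval scale p (\<lambda>v. scale c (\<phi> v))"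
proof -
  have "((\<lambda>v. scale c (\<phi> v)) ^^ i) v = scale (c ^ i) ((\<phi> ^^ i) v)" for i v
  proof (induction i)
    case (Suc i)
    then show ?case using pow.scale [of 1] by simp
  qed simp
  then show ?thesis
    by (intro ext) (simp add: fps_eval_def mult.commute)
qed

text \<open>An operator \<open>T\<close> that commutes with \<open>\<phi>\<close> up to the factor \<open>c\<close> passes through a power series at the
  cost of a dilation; in combination with the functional equation this moves \<open>y\<close> through a \<open>q\<close>-exponential.\<close>

lemma fps_eval_skew_commute:
  assumes T: "Vector_Spaces.linear scale scale T" and comm: "\<And>v. \<phi> (T v) = scale c (T (\<phi> v))"
  shows "fps_eval scale p \<phi> (T v) = T (fps_eval scale (fps_dilate c p) \<phi> v)"
proof -
  interpret T: Vector_Spaces.linear scale scale T by (rule T)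
  have "(\<phi> ^^ i) (T v) = scale (c ^ i) (T ((\<phi> ^^ i) v))" for i
  proof (induction i)
    case (Suc i)
    then show ?case using pow.scale [of 1] by (simp add: comm mult.commute)
  qed simp
  then show ?thesis
    by (simp add: fps_eval_eq_sum [OF order_refl] T.sum T.scale mult.commute)
qed

lemma exp_q_inverse:
  assumes "not_root_of_unity q"
  shows "exp_q scale q \<phi> (exp_q scale (inverse q) (\<lambda>v. - \<phi> v) v) = v"
    and "exp_q scale (inverse q) (\<lambda>v. - \<phi> v) (exp_q scale q \<phi> v) = v"
proof -
  have 1: "exp_q scale (inverse q) (\<lambda>v. - \<phi> v) =
      fps_eval scale (fps_dilate (- 1) (exp_q_fps (inverse q))) \<phi>"
    by (simp add: exp_q_eq_fps_eval fps_eval_dilate)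
  show "exp_q scale q \<phi> (exp_q scale (inverse q) (\<lambda>v. - \<phi> v) v) = v"
    "exp_q scale (inverse q) (\<lambda>v. - \<phi> v) (exp_q scale q \<phi> v) = v"
    using not_root_of_unity.exp_q_fps_inverse [OF assms]
    by (simp_all only: 1 exp_q_eq_fps_eval [of scale q] fps_eval_mult [symmetric] fps_eval_1
        mult.commute [of "fps_dilate _ _"])
qed

end

section \<open>Spaces spanned by weight vectors\<close>

text \<open>The property of a finite-dimensional module of type 1 that the proof rests on, stated for the
  operator \<open>Y\<close> by which \<open>y\<close> (or \<open>k\<close>) acts. The weight of an eigenvector is the exponent \<open>\<mu>\<close>.\<close>

locale weighted_space = vector_space scale + not_root_of_unity q
  for scale :: "'f::field \<Rightarrow> 'v::ab_group_add \<Rightarrow> 'v" and q :: 'f +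
  fixes Y :: "'v \<Rightarrow> 'v"
  assumes linear_Y: "Vector_Spaces.linear scale scale Y"
    and weight_spanned: "\<exists>B. finite B \<and> span B = UNIV \<and> (\<forall>b\<in>B. \<exists>\<mu>::int. Y b = scale (q powi \<mu>) b)"
begin

sublocale Y: Vector_Spaces.linear scale scale Y
  by (rule linear_Y)

lemma linear_eq_weightI:
  assumes "Vector_Spaces.linear scale scale S" and "Vector_Spaces.linear scale scale T"
    and "\<And>v \<mu>. Y v = scale (q powi \<mu>) v \<Longrightarrow> S v = T v"
  shows "S v = T v"
proof -
  interpret vector_space_pair scale scale ..
  obtain B where "span B = UNIV" and "\<forall>b\<in>B. \<exists>\<mu>::int. Y b = scale (q powi \<mu>) b"
    using weight_spanned by blast
  then show ?thesis
    by (intro linear_eq_on [OF assms(1,2), of v B]) (use assms(3) in auto)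
qed

text \<open>Thin the spanning family to a basis. If a weight vector \<open>v\<close> of weight \<open>\<mu>\<close> has a nonzero coefficient
  at \<open>b\<close>, comparing the coefficients of \<open>Y v\<close> and \<open>q\<^sup>\<mu> v\<close> at \<open>b\<close> shows that \<open>b\<close> also has weight \<open>\<mu>\<close>, because
  distinct integer powers of \<open>q\<close> are distinct.\<close>

lemma weight_basis:
  obtains B and w :: "'v \<Rightarrow> int" where "finite B" and "independent B" and "span B = UNIV"
    and "\<And>b. b \<in> B \<Longrightarrow> Y b = scale (q powi w b) b"
    and "\<And>v \<mu> b. Y v = scale (q powi \<mu>) v \<Longrightarrow> b \<in> B \<Longrightarrow> representation B v b \<noteq> 0 \<Longrightarrow> w b = \<mu>"
proof -
  obtain B0 where B0: "finite B0" "span B0 = UNIV" "\<forall>b\<in>B0. \<exists>\<mu>::int. Y b = scale (q powi \<mu>) b"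
    using weight_spanned by blast
  obtain B where B: "B \<subseteq> B0" "independent B" "B0 \<subseteq> span B"
    using maximal_independent_subset by blast
  have fin: "finite B"
    using B(1) B0(1) finite_subset by blast
  have span: "span B = UNIV"
    using B(3) B0(2) span_mono [OF B(3)] by (simp add: span_span top.extremum_unique)
  obtain w where w: "\<And>b. b \<in> B \<Longrightarrow> Y b = scale (q powi w b) b"
    using B0(3) B(1) by (metis subsetD)
  have "w b = \<mu>"
    if v: "Y v = scale (q powi \<mu>) v" and b: "b \<in> B" and nz: "representation B v b \<noteq> 0" for v \<mu> b
  proof -
    let ?r = "representation B v"
    have sum: "(\<Sum>b\<in>B. scale (?r b) b) = v"
      by (rule sum_representation_eq) (use B(2) fin span in auto)
    have "Y v = (\<Sum>b\<in>B. scale (?r b * q powi w b) b)"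
      by (subst sum [symmetric]) (simp add: Y.sum Y.scale w)
    moreover have "scale (q powi \<mu>) v = (\<Sum>b\<in>B. scale (?r b * q powi \<mu>) b)"
      by (subst sum [symmetric]) (simp add: scale_sum_right mult.commute)
    ultimately have "(\<Sum>b\<in>B. scale (?r b * q powi w b - ?r b * q powi \<mu>) b) = 0"
      using v by (simp add: scale_left_diff_distrib sum_subtractf)
    then have "?r b * q powi w b - ?r b * q powi \<mu> = 0"
      using independentD [OF B(2) fin subset_refl _ b, of "\<lambda>b. ?r b * q powi w b - ?r b * q powi \<mu>"]
      by simp
    then show "w b = \<mu>"
      using nz by (simp add: q_powi_eq_iff)
  qed
  with that fin B(2) span w show thesis by blast
qed

lemma weight_bounded: "\<exists>M::nat. \<forall>v \<mu>. Y v = scale (q powi \<mu>) v \<longrightarrow> v \<noteq> 0 \<longrightarrow> \<bar>\<mu>\<bar> \<le> int M"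
proof -
  obtain B w where B: "finite B" "independent B" "span B = UNIV"
    and w: "\<And>v \<mu> b. Y v = scale (q powi \<mu>) v \<Longrightarrow> b \<in> B \<Longrightarrow> representation B v b \<noteq> 0 \<Longrightarrow> w b = \<mu>"
    using weight_basis by metis
  have "\<bar>\<mu>\<bar> \<le> int (\<Sum>b\<in>B. nat \<bar>w b\<bar>)" if v: "Y v = scale (q powi \<mu>) v" and "v \<noteq> 0" for v \<mu>
  proof -
    have "(\<Sum>b\<in>B. scale (representation B v b) b) = v"
      by (rule sum_representation_eq) (use B in auto)
    with \<open>v \<noteq> 0\<close> obtain b where b: "b \<in> B" "representation B v b \<noteq> 0"
      by (metis (no_types, lifting) scale_eq_0_iff sum.neutral)
    then have "w b = \<mu>"
      using w v by blast
    moreover have "nat \<bar>w b\<bar> \<le> (\<Sum>b\<in>B. nat \<bar>w b\<bar>)"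
      by (rule member_le_sum) (use B b in auto)
    ultimately show ?thesis by linarith
  qed
  then show ?thesis by blast
qed

text \<open>Prescribe the values on a basis of weight vectors. The basis meets only the weights of its own
  members, but by \<open>weight_basis\<close> an arbitrary vector of weight \<open>\<mu>\<close> involves only basis vectors of weight \<open>\<mu>\<close>.\<close>

lemma weight_operator_exists:
  "\<exists>T. Vector_Spaces.linear scale scale T \<and> (\<forall>\<mu> v. Y v = scale (q powi \<mu>) v \<longrightarrow> T v = scale (g \<mu>) v)"
proof -
  interpret vector_space_pair scale scale ..
  obtain B w where B: "finite B" "independent B" "span B = UNIV"
    and w: "\<And>v \<mu> b. Y v = scale (q powi \<mu>) v \<Longrightarrow> b \<in> B \<Longrightarrow> representation B v b \<noteq> 0 \<Longrightarrow> w b = \<mu>"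
    using weight_basis by metis
  obtain T where T: "Vector_Spaces.linear scale scale T" "\<forall>b\<in>B. T b = scale (g (w b)) b"
    using linear_independent_extend [OF B(2), of "\<lambda>b. scale (g (w b)) b"] by blast
  interpret T: Vector_Spaces.linear scale scale T by (rule T(1))
  have "T v = scale (g \<mu>) v" if v: "Y v = scale (q powi \<mu>) v" for v \<mu>
  proof -
    let ?r = "representation B v"
    have sum: "(\<Sum>b\<in>B. scale (?r b) b) = v"
      by (rule sum_representation_eq) (use B in auto)
    have "T v = (\<Sum>b\<in>B. scale (?r b * g (w b)) b)"
      by (subst sum [symmetric]) (simp add: T.sum T.scale T(2))
    also have "\<dots> = (\<Sum>b\<in>B. scale (?r b * g \<mu>) b)"
      by (rule sum.cong) (use w [OF v] in fastforce)+
    also have "\<dots> = scale (g \<mu>) v"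
      by (subst (2) sum [symmetric]) (simp add: scale_sum_right mult.commute)
    finally show ?thesis .
  qed
  with T(1) show ?thesis by blast
qed

text \<open>Each application of \<open>C\<close> raises the weight by \<open>2\<close>, whereas the weights of nonzero vectors are
  bounded by some \<open>M\<close>; after \<open>M + 1\<close> steps the weight is out of range.\<close>

lemma weight_raising_nilpotent:
  assumes C: "Vector_Spaces.linear scale scale C"
    and raise: "\<And>v. Y (C v) = scale (q ^ 2) (C (Y v))"
  shows "\<exists>N. \<forall>v. (C ^^ N) v = 0"
proof -
  interpret C: Vector_Spaces.linear scale scale C by (rule C)
  obtain M :: nat where M: "\<And>v \<mu>. Y v = scale (q powi \<mu>) v \<Longrightarrow> v \<noteq> 0 \<Longrightarrow> \<bar>\<mu>\<bar> \<le> int M"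
    using weight_bounded by blast
  have "(C ^^ Suc M) v = 0" for v
  proof (rule linear_eq_weightI [of "C ^^ Suc M" "\<lambda>v. 0"])
    fix v \<mu> assume v: "Y v = scale (q powi \<mu>) v"
    have wt: "Y ((C ^^ i) v) = scale (q powi (\<mu> + 2 * int i)) ((C ^^ i) v)" for i
    proof (induction i)
      case (Suc i)
      have "q powi (\<mu> + 2 * int (Suc i)) = q ^ 2 * q powi (\<mu> + 2 * int i)"
        using q_nonzero by (simp add: power_int_add power2_eq_square algebra_simps)
      then show ?case by (simp add: raise Suc C.scale)
    qed (simp add: v)
    show "(C ^^ Suc M) v = 0"
    proof (rule ccontr)
      assume nz: "(C ^^ Suc M) v \<noteq> 0"
      interpret pow: Vector_Spaces.linear scale scale "C ^^ Suc M"
        by (rule linear_funpow [OF C])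
      have "v \<noteq> 0"
        using nz pow.zero by metis
      with M [OF v] M [OF wt nz] show False by simp
    qed
  next
    show "Vector_Spaces.linear scale scale (C ^^ Suc M)"
      by (rule linear_funpow [OF C])
  qed (rule linear_operatorI; simp)
  then show ?thesis by blast
qed

end

section \<open>The equitable relations\<close>

text \<open>The common shape of \<open>n\<^sub>x\<close>, \<open>n\<^sub>y\<close>, \<open>n\<^sub>z\<close>, as operators built from two equitable generators.\<close>

definition equitable_nil ::
  "('f::field \<Rightarrow> 'v::ab_group_add \<Rightarrow> 'v) \<Rightarrow> 'f \<Rightarrow> ('v \<Rightarrow> 'v) \<Rightarrow> ('v \<Rightarrow> 'v) \<Rightarrow> 'v \<Rightarrow> 'v" where
  "equitable_nil scale q S T v = scale (q / (q - inverse q)) (v - S (T v))"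

text \<open>A representation of the equitable presentation in which \<open>Y\<close> has a spanning set of weight vectors;
  \<open>Yi\<close> is the inverse of \<open>Y\<close>. The module structure over \<open>Uq q\<close> is left out so that the locale can be
  interpreted once more with \<open>x\<close> and \<open>z\<close> exchanged and \<open>q\<close> inverted.\<close>

locale equitable_action = weighted_space scale q Y
  for scale :: "'f::field \<Rightarrow> 'v::ab_group_add \<Rightarrow> 'v" and q :: 'f and Y :: "'v \<Rightarrow> 'v" +
  fixes X Yi Z :: "'v \<Rightarrow> 'v"
  assumes linear_X: "Vector_Spaces.linear scale scale X"
    and linear_Yi: "Vector_Spaces.linear scale scale Yi"
    and linear_Z: "Vector_Spaces.linear scale scale Z"
    and Y_Yi: "Y (Yi v) = v"
    and Yi_Y: "Yi (Y v) = v"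
    and qXY: "scale q (X (Y v)) - scale (inverse q) (Y (X v)) = scale (q - inverse q) v"
    and qYZ: "scale q (Y (Z v)) - scale (inverse q) (Z (Y v)) = scale (q - inverse q) v"
    and qZX: "scale q (Z (X v)) - scale (inverse q) (X (Z v)) = scale (q - inverse q) v"
begin

sublocale X: Vector_Spaces.linear scale scale X by (rule linear_X)
sublocale Yi: Vector_Spaces.linear scale scale Yi by (rule linear_Yi)
sublocale Z: Vector_Spaces.linear scale scale Z by (rule linear_Z)

abbreviation "nz \<equiv> equitable_nil scale q X Y"

lemma linear_nz: "Vector_Spaces.linear scale scale nz"
  by (rule linear_operatorI)
    (simp_all add: equitable_nil_def X.add X.scale Y.add Y.scale scale_right_distrib
      scale_right_diff_distrib mult.commute)

sublocale nz: Vector_Spaces.linear scale scale nz by (rule linear_nz)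

lemma q2_neq_1: "q ^ 2 \<noteq> 1"
  using q_power_neq_1 [of 2] by simp

lemma XY_eq: "X (Y v) = v - scale (1 - inverse q ^ 2) (nz v)"
proof -
  have "(1 - inverse q ^ 2) * (q / (q - inverse q)) = 1"
    using q_nonzero q_minus_inverse_neq_0 by (simp add: field_simps power2_eq_square)
  then show ?thesis by (simp add: equitable_nil_def)
qed

lemma YX_eq: "Y (X v) = v - scale (q ^ 2 - 1) (nz v)"
proof -
  have "scale (inverse q) (Y (X v)) = scale q (X (Y v)) - scale (q - inverse q) v"
    using qXY [of v] by (simp add: algebra_simps)
  then have "Y (X v) = scale q (scale q (X (Y v)) - scale (q - inverse q) v)"
    using q_nonzero by (metis right_inverse scale_one scale_scale)
  moreover have "q * (q * (1 - inverse q ^ 2)) = q ^ 2 - 1" "q * (q - inverse q) = q ^ 2 - 1"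
      "q * q = q ^ 2"
    using q_nonzero by (simp_all add: field_simps power2_eq_square)
  ultimately show ?thesis
    by (simp add: XY_eq scale_right_diff_distrib) (simp add: scale_left_diff_distrib)
qed

lemma Y_nz: "Y (nz v) = scale (q ^ 2) (nz (Y v))"
proof -
  have "Y (nz v) = scale (q / (q - inverse q)) (Y v - Y (X (Y v)))"
    by (simp add: equitable_nil_def Y.scale Y.diff)
  moreover have "q / (q - inverse q) * (q ^ 2 - 1) = q ^ 2"
    using q_nonzero q_minus_inverse_neq_0 by (simp add: field_simps power2_eq_square)
  ultimately show ?thesis by (simp add: YX_eq)
qed

lemma nz_Y: "nz (Y v) = scale (inverse q ^ 2) (Y (nz v))"
  using q_nonzero by (simp add: Y_nz power_inverse)

lemma nz_Yi: "nz (Yi v) = scale (q ^ 2) (Yi (nz v))"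
  using Y_nz [of "Yi v"] by (metis Y_Yi Yi.scale Yi_Y)

lemma X_eq: "X v = Yi v - scale (q ^ 2 - 1) (Yi (nz v))"
proof -
  have "(1 - inverse q ^ 2) * q ^ 2 = q ^ 2 - 1"
    using q_nonzero by (simp add: field_simps power2_eq_square)
  then show ?thesis
    using XY_eq [of "Yi v"] by (simp add: Y_Yi nz_Yi)
qed

text \<open>Expand \<open>n\<^sub>z\<close>. In \<open>x y z\<close> and \<open>z x y\<close> the relations for \<open>y z\<close> and \<open>z x\<close> produce the same
  term \<open>q\<^sup>-\<^sup>2 x z y\<close>, which cancels.\<close>

lemma nz_Z: "nz (Z v) = Z (nz v) + Y v - X v"
proof -
  let ?d = "q - inverse q"
  have XYZ: "scale q (X (Y (Z v))) = scale ?d (X v) + scale (inverse q) (X (Z (Y v)))"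
    using arg_cong [OF qYZ [of v], of X] by (simp add: X.diff X.scale algebra_simps)
  have ZXY: "scale q (Z (X (Y v))) = scale ?d (Y v) + scale (inverse q) (X (Z (Y v)))"
    using qZX [of "Y v"] by (simp add: algebra_simps)
  have "scale ?d (nz (Z v) - Z (nz v)) = scale q (Z (X (Y v))) - scale q (X (Y (Z v)))"
    using q_minus_inverse_neq_0
    by (simp add: equitable_nil_def Z.scale Z.diff scale_right_diff_distrib)
  also have "\<dots> = scale ?d (Y v - X v)"
    by (simp add: XYZ ZXY scale_right_diff_distrib)
  finally have "nz (Z v) - Z (nz v) = Y v - X v"
    using q_minus_inverse_neq_0 by simp
  then show ?thesis by (simp add: algebra_simps)
qed

lemma nz_Z_eq: "nz (Z v) = Z (nz v) + Y v - Yi v + scale (q ^ 2 - 1) (Yi (nz v))"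
  by (simp add: nz_Z X_eq [of v])

text \<open>Iterating the commutator: the summands \<open>y\<close>, \<open>y\<^sup>-\<^sup>1\<close> and \<open>n\<^sub>z y\<^sup>-\<^sup>1\<close> are moved to the left of the powers
  of \<open>n\<^sub>z\<close>, and the coefficients are the resulting geometric sums with ratios \<open>q\<^sup>-\<^sup>2\<close> and \<open>q\<^sup>2\<close>.\<close>

lemma nz_funpow_Z:
  "(nz ^^ Suc i) (Z v) = Z ((nz ^^ Suc i) v)
    + scale ((q ^ (2 * Suc i) - 1) / (q ^ (2 * i) * (q ^ 2 - 1))) (Y ((nz ^^ i) v))
    - scale ((q ^ (2 * Suc i) - 1) / (q ^ 2 - 1)) (Yi ((nz ^^ i) v))
    + scale (q ^ (2 * Suc i) - 1) (Yi ((nz ^^ Suc i) v))"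
proof (induction i)
  case 0
  then show ?case using q2_neq_1 by (simp add: nz_Z_eq)
next
  case (Suc i)
  let ?p = "\<lambda>i. (q ^ (2 * Suc i) - 1) / (q ^ (2 * i) * (q ^ 2 - 1))"
    and ?m = "\<lambda>i. (q ^ (2 * Suc i) - 1) / (q ^ 2 - 1)" and ?e = "\<lambda>i. q ^ (2 * Suc i) - 1"
    and ?u = "(nz ^^ Suc i) v"
  have p: "?p (Suc i) = 1 + ?p i * inverse q ^ 2" and m: "?m (Suc i) = 1 + ?m i * q ^ 2"
    and e: "?e (Suc i) = q ^ 2 - 1 + ?e i * q ^ 2"
    using q_nonzero q2_neq_1 by (simp_all add: field_simps power2_eq_square)
  have "(nz ^^ Suc (Suc i)) (Z v) = nz ((nz ^^ Suc i) (Z v))"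
    by simp
  also have "\<dots> = nz (Z ?u) + scale (?p i) (nz (Y ((nz ^^ i) v)))
      - scale (?m i) (nz (Yi ((nz ^^ i) v))) + scale (?e i) (nz (Yi ?u))"
    by (simp only: Suc.IH nz.add nz.diff nz.scale)
  also have "nz (Z ?u) = Z (nz ?u) + Y ?u - Yi ?u + scale (q ^ 2 - 1) (Yi (nz ?u))"
    by (rule nz_Z_eq)
  also have "nz (Y ((nz ^^ i) v)) = scale (inverse q ^ 2) (Y ?u)"
    by (simp add: nz_Y)
  also have "nz (Yi ((nz ^^ i) v)) = scale (q ^ 2) (Yi ?u)"
    by (simp add: nz_Yi)
  also have "nz (Yi ?u) = scale (q ^ 2) (Yi (nz ?u))"
    by (simp only: nz_Yi)
  finally show ?case
    unfolding p m unfolding e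
    by (simp add: scale_left_distrib del: mult_Suc_right power_Suc)
qed

lemma nz_nilpotent: "\<exists>N. nilpotent_operator scale nz N"
  using weight_raising_nilpotent [OF linear_nz Y_nz] linear_nz vector_space_axioms
  by (auto simp: nilpotent_operator_def nilpotent_operator_axioms_def)

section \<open>Conjugation by the two $q$-exponentials\<close>

abbreviation "E \<equiv> exp_q scale q nz"

lemma linear_E: "Vector_Spaces.linear scale scale E"
  using nz_nilpotent by (auto simp: exp_q_eq_fps_eval nilpotent_operator.linear_fps_eval)

lemma E_inverse:
  "E (exp_q scale (inverse q) (\<lambda>v. - nz v) v) = v"
  "exp_q scale (inverse q) (\<lambda>v. - nz v) (E v) = v"
  using nz_nilpotent nilpotent_operator.exp_q_inverse not_root_of_unity_axioms by blast+

text \<open>By the functional equation, dilating \<open>exp\<^sub>q\<close> by \<open>q\<^sup>-\<^sup>2\<close> multiplies it by \<open>1 - (1 - q\<^sup>-\<^sup>2) \<phi>\<close>, which at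
  \<open>\<phi> = n\<^sub>z\<close> is \<open>x y\<close>. Hence \<open>E y = y (x y E) = y (E x y)\<close>, the order of the two series being immaterial; the
  second form yields the claim about \<open>x\<close> after cancelling \<open>y\<close>.\<close>

lemma E_Y: "E (Y v) = Y (X (Y (E v)))" and Y_E_X: "Y (E (X v)) = E v"
proof -
  obtain N where "nilpotent_operator scale nz N"
    using nz_nilpotent by blast
  then interpret nz: nilpotent_operator scale nz N .
  let ?L = "1 - fps_const (1 - inverse q ^ 2) * fps_X"
  have "fps_dilate (inverse q ^ 2) (1 - fps_const (q ^ 2 - 1) * fps_X) = ?L"
    using q_nonzero by (intro fps_ext) (auto simp: fps_X_def field_simps)
  moreover have "inverse q ^ 2 * q ^ 2 = 1"
    using q_nonzero by (simp add: power_inverse)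
  ultimately have dil: "fps_dilate (inverse q ^ 2) (exp_q_fps q) = ?L * exp_q_fps q"
    by (subst exp_q_fps_dilate) (simp add: fps_dilate_mult fps_dilate_dilate)
  have *: "fps_eval scale ?L nz v = X (Y v)" for v
    by (simp add: nz.fps_eval_linear_factor XY_eq)
  have EY: "E (Y v) = Y (fps_eval scale (fps_dilate (inverse q ^ 2) (exp_q_fps q)) nz v)" for v
    unfolding exp_q_eq_fps_eval by (rule nz.fps_eval_skew_commute [OF linear_Y nz_Y])
  show "E (Y v) = Y (X (Y (E v)))"
    by (simp only: EY dil nz.fps_eval_mult *) (simp only: exp_q_eq_fps_eval)
  have "E (Y (Yi v)) = Y (E (X (Y (Yi v))))"
    by (simp only: EY dil mult.commute [of ?L] nz.fps_eval_mult *) (simp only: exp_q_eq_fps_eval)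
  then show "Y (E (X v)) = E v"
    by (simp add: Y_Yi)
qed

lemma E_X: "E (X v) = Yi (E v)"
  by (metis Y_E_X Yi_Y)

text \<open>Multiply \<open>nz_funpow_Z\<close> by the coefficients of \<open>exp\<^sub>q\<close> and sum. The recursion for the coefficients
  turns the \<open>Y\<close>-part into \<open>Y E\<close> and the first \<open>Y\<^sup>-\<^sup>1\<close>-part into the sum \<open>?S\<close> below; the second \<open>Y\<^sup>-\<^sup>1\<close>-part
  is \<open>?S - Y\<^sup>-\<^sup>1 E\<close>, so that \<open>?S\<close> drops out.\<close>

lemma E_Z: "E (Z v) = Z (E v) + Y (E v) - Yi (E v)"
proof -
  obtain N where "nilpotent_operator scale nz N"
    using nz_nilpotent by blast
  then interpret nz: nilpotent_operator scale nz N .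
  let ?a = "\<lambda>i. exp_q_fps q $ i"
  have E: "E u = (\<Sum>i<N. scale (?a i) ((nz ^^ i) u))" for u
    unfolding exp_q_eq_fps_eval by (rule nz.fps_eval_eq_sum) simp
  \<comment> \<open>One summand more than needed, so that the index can be shifted to match \<open>nz_funpow_Z\<close>.\<close>
  have E_Suc: "E u = scale (?a 0) u + (\<Sum>i<N. scale (?a (Suc i)) ((nz ^^ Suc i) u))" for u
  proof -
    have "E u = (\<Sum>i<Suc N. scale (?a i) ((nz ^^ i) u))"
      unfolding exp_q_eq_fps_eval by (rule nz.fps_eval_eq_sum) simp
    then show ?thesis
      by (simp only: sum.lessThan_Suc_shift) simp
  qed
  let ?S = "\<Sum>i<N. scale (?a i * q ^ (2 * i)) (Yi ((nz ^^ i) v))"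
  have p: "?a (Suc i) * ((q ^ (2 * Suc i) - 1) / (q ^ (2 * i) * (q ^ 2 - 1))) = ?a i"
    and m: "?a (Suc i) * ((q ^ (2 * Suc i) - 1) / (q ^ 2 - 1)) = ?a i * q ^ (2 * i)" for i
    using exp_q_fps_nth_Suc [of i] q_nonzero q2_neq_1 by (simp_all del: mult_Suc_right)
  have Y_E: "(\<Sum>i<N. scale (?a i) (Y ((nz ^^ i) v))) = Y (E v)"
    by (simp add: E Y.sum Y.scale)
  have Yi_E: "(\<Sum>i<N. scale (?a (Suc i) * (q ^ (2 * Suc i) - 1)) (Yi ((nz ^^ Suc i) v))) = ?S - Yi (E v)"
  proof -
    let ?h = "\<lambda>i. scale (?a i * (q ^ (2 * i) - 1)) (Yi ((nz ^^ i) v))"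
    have "(\<Sum>i<N. ?h (Suc i)) = (\<Sum>i<Suc N. ?h i)"
      by (simp only: sum.lessThan_Suc_shift) simp
    also have "\<dots> = (\<Sum>i<N. ?h i)"
      by (simp add: nz.nilpotent)
    also have "\<dots> = ?S - Yi (E v)"
      by (simp add: E Yi.sum Yi.scale right_diff_distrib scale_left_diff_distrib sum_subtractf)
    finally show ?thesis .
  qed
  have "E (Z v) = scale (?a 0) (Z v) + (\<Sum>i<N. scale (?a (Suc i)) (Z ((nz ^^ Suc i) v))
      + scale (?a i) (Y ((nz ^^ i) v)) - scale (?a i * q ^ (2 * i)) (Yi ((nz ^^ i) v))
      + scale (?a (Suc i) * (q ^ (2 * Suc i) - 1)) (Yi ((nz ^^ Suc i) v)))"
    unfolding E_Suc nz_funpow_Z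
    by (simp only: scale_right_distrib scale_right_diff_distrib scale_scale p m)
  also have "\<dots> = Z (E v) + Y (E v) - ?S + (?S - Yi (E v))"
    unfolding sum.distrib sum_subtractf Y_E Yi_E
    by (simp add: E_Suc [of v] Z.add Z.sum Z.scale)
  finally show ?thesis by simp
qed

text \<open>The symmetry that exchanges \<open>x\<close> and \<open>z\<close> and inverts \<open>q\<close>: each of the three equitable relations is
  mapped to the negative of one of them, and a weight \<open>\<mu>\<close> becomes \<open>- \<mu>\<close>.\<close>

lemma equitable_action_dual: "equitable_action scale (inverse q) Y Z Yi X"
proof (intro equitable_action.intro weighted_space.intro equitable_action_axioms.intro
    weighted_space_axioms.intro)
  obtain B where "finite B" "span B = UNIV" "\<forall>b\<in>B. \<exists>\<mu>::int. Y b = scale (q powi \<mu>) b"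
    using weight_spanned by blast
  moreover have "q powi \<mu> = inverse q powi (- \<mu>)" for \<mu>
    using q_nonzero by (simp add: power_int_minus power_int_inverse)
  ultimately show "\<exists>B. finite B \<and> span B = UNIV \<and> (\<forall>b\<in>B. \<exists>\<mu>::int. Y b = scale (inverse q powi \<mu>) b)"
    by metis
  show "scale (inverse q) (Z (Y v)) - scale (inverse (inverse q)) (Y (Z v)) =
      scale (inverse q - inverse (inverse q)) v" for v
    using qYZ [of v] by (simp add: algebra_simps)
  show "scale (inverse q) (Y (X v)) - scale (inverse (inverse q)) (X (Y v)) =
      scale (inverse q - inverse (inverse q)) v" for v
    using qXY [of v] by (simp add: algebra_simps)
  show "scale (inverse q) (X (Z v)) - scale (inverse (inverse q)) (Z (X v)) =
      scale (inverse q - inverse (inverse q)) v" for v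
    using qZX [of v] by (simp add: algebra_simps)
qed (simp_all add: vector_space_axioms not_root_of_unity_inverse linear_X linear_Y linear_Z linear_Yi
    Y_Yi Yi_Y)

interpretation dual: equitable_action scale "inverse q" Y Z Yi X
  by (rule equitable_action_dual)

abbreviation "nx \<equiv> equitable_nil scale q Y Z"
abbreviation "F \<equiv> exp_q scale q nx"

lemma dual_nz: "equitable_nil scale (inverse q) Z Y v = - nx v"
proof -
  let ?d = "q - inverse q"
  have "scale ?d (equitable_nil scale (inverse q) Z Y v) = scale ?d (- nx v)"
  proof -
    have "?d * (inverse q / (inverse q - q)) = - inverse q"
    proof -
      have "inverse q - q = - ?d" by simp
      then show ?thesis using q_minus_inverse_neq_0 by (simp only: minus_divide_right [symmetric]) simp
    qed
    then show ?thesis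
      using qYZ [of v] q_minus_inverse_neq_0
      by (simp add: equitable_nil_def) (simp add: algebra_simps)
  qed
  then show ?thesis by (rule scale_left_imp_eq [OF q_minus_inverse_neq_0])
qed

text \<open>The \<open>E\<close> of the dual action is \<open>exp\<close> with parameter \<open>q\<^sup>-\<^sup>1\<close> of \<open>- n\<^sub>x\<close>, which is the inverse of \<open>F\<close>.\<close>

lemma F_inverse:
  "F (dual.E v) = v" "dual.E (F v) = v"
  using dual.E_inverse [of v] by (simp_all add: dual_nz)

lemma linear_nx: "Vector_Spaces.linear scale scale nx"
  by (rule linear_operatorI)
    (simp_all add: equitable_nil_def Z.add Z.scale Y.add Y.scale scale_right_distrib
      scale_right_diff_distrib mult.commute)

lemma Y_nx: "Y (nx v) = scale (inverse q ^ 2) (nx (Y v))"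
  using dual.Y_nz [of v] by (simp add: dual_nz Y.neg)

lemma linear_F: "Vector_Spaces.linear scale scale F"
proof (rule linear_operatorI)
  interpret D: Vector_Spaces.linear scale scale dual.E by (rule dual.linear_E)
  have "F (u + v) = F (dual.E (F u + F v))" for u v
    by (simp only: D.add F_inverse)
  then show "F (u + v) = F u + F v" for u v
    by (simp only: F_inverse)
  have "F (scale c v) = F (dual.E (scale c (F v)))" for c v
    by (simp only: D.scale F_inverse)
  then show "F (scale c v) = scale c (F v)" for c v
    by (simp only: F_inverse)
qed

text \<open>The identities for \<open>E\<close> in the dual action, multiplied on both sides by \<open>F\<close>.\<close>

lemma Z_F: "Z (F v) = F (Yi v)"
  by (metis F_inverse dual.E_X)

lemma X_F: "X (F v) = F (X v + Y v - Yi v)"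
  by (metis F_inverse dual.E_Z)

lemma Y_F: "Y (F v) = F (Y (Z (Y v)))"
  by (metis F_inverse dual.E_Y)

section \<open>The rotator\<close>

lemma YZ_eq: "Y (Z v) = v - scale (1 - inverse q ^ 2) (nx v)"
  using dual.YX_eq [of v] by (simp add: dual_nz scale_left_diff_distrib)

lemma Z_eq: "Z v = Yi v - scale (1 - inverse q ^ 2) (Yi (nx v))"
  using dual.X_eq [of v] by (simp add: dual_nz Yi.neg scale_left_diff_distrib)

context
  fixes s :: 'f and T :: "'v \<Rightarrow> 'v"
  assumes s: "s ^ 2 = q"
    and linear_T: "Vector_Spaces.linear scale scale T"
    and T_weight: "\<And>\<mu> v. Y v = scale (q powi \<mu>) v \<Longrightarrow> T v = scale (s powi (- (\<mu> ^ 2))) v"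
begin

interpretation T: Vector_Spaces.linear scale scale T by (rule linear_T)

lemma s_nonzero: "s \<noteq> 0"
  using s q_nonzero by auto

lemma q_powi_eq_s_powi: "q powi \<mu> = s powi (2 * \<mu>)"
  using s by (simp add: power_int_mult)

text \<open>The inverse is the operator with the reciprocal weights.\<close>

lemma bij_T: "bij T"
proof -
  obtain T' where T': "Vector_Spaces.linear scale scale T'"
    "\<And>\<mu> v. Y v = scale (q powi \<mu>) v \<Longrightarrow> T' v = scale (s powi (\<mu> ^ 2)) v"
    using weight_operator_exists [of "\<lambda>\<mu>. s powi (\<mu> ^ 2)"] by blast
  interpret T': Vector_Spaces.linear scale scale T' by (rule T'(1))
  have unit: "s powi (- (\<mu> ^ 2)) * s powi (\<mu> ^ 2) = 1" for \<mu> :: int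
    using s_nonzero by (simp add: power_int_minus)
  have id: "Vector_Spaces.linear scale scale (\<lambda>v. v)"
    by (rule linear_operatorI) simp_all
  have "T (T' v) = v" for v
  proof (rule linear_eq_weightI [of "\<lambda>v. T (T' v)", OF _ id])
    show "Vector_Spaces.linear scale scale (\<lambda>v. T (T' v))"
      using Vector_Spaces.linear_compose [OF T'(1) linear_T] by (simp add: o_def)
    show "T (T' v) = v" if "Y v = scale (q powi \<mu>) v" for v \<mu>
      by (simp add: T'(2) [OF that] T_weight [OF that] T.scale unit mult.commute [of "s powi (\<mu> ^ 2)"])
  qed
  moreover have "T' (T v) = v" for v
  proof (rule linear_eq_weightI [of "\<lambda>v. T' (T v)", OF _ id])
    show "Vector_Spaces.linear scale scale (\<lambda>v. T' (T v))"
      using Vector_Spaces.linear_compose [OF linear_T T'(1)] by (simp add: o_def)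
    show "T' (T v) = v" if "Y v = scale (q powi \<mu>) v" for v \<mu>
      by (simp add: T'(2) [OF that] T_weight [OF that] T'.scale unit)
  qed
  ultimately show ?thesis
    by (intro o_bij [of T']) (simp_all add: fun_eq_iff)
qed

lemma Yi_weight:
  assumes "Y v = scale (q powi \<mu>) v"
  shows "Yi v = scale (q powi (- \<mu>)) v"
proof -
  have "v = scale (q powi \<mu>) (Yi v)"
    using arg_cong [OF assms, of Yi] by (simp add: Yi_Y Yi.scale)
  then have "scale (q powi (- \<mu>)) v = scale (q powi (- \<mu>) * q powi \<mu>) (Yi v)"
    by (metis scale_scale)
  then show ?thesis
    using q_nonzero by (simp add: power_int_minus)
qed

lemma nz_weight:
  assumes "Y v = scale (q powi \<mu>) v"
  shows "Y (nz v) = scale (q powi (\<mu> + 2)) (nz v)"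
  using q_nonzero by (simp add: Y_nz assms nz.scale power_int_add mult.commute)

lemma nx_weight:
  assumes "Y v = scale (q powi \<mu>) v"
  shows "Y (nx v) = scale (q powi (\<mu> - 2)) (nx v)"
proof -
  interpret nx: Vector_Spaces.linear scale scale nx by (rule linear_nx)
  show ?thesis
    using q_nonzero by (simp add: Y_nx assms nx.scale power_int_diff power_inverse field_simps)
qed

lemma T_Y: "T (Y v) = Y (T v)"
proof (rule linear_eq_weightI [of "\<lambda>v. T (Y v)" "\<lambda>v. Y (T v)"])
  show "Vector_Spaces.linear scale scale (\<lambda>v. T (Y v))"
    by (rule linear_operatorI) (simp_all add: T.add T.scale Y.add Y.scale)
  show "Vector_Spaces.linear scale scale (\<lambda>v. Y (T v))"
    by (rule linear_operatorI) (simp_all add: T.add T.scale Y.add Y.scale)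
  show "T (Y v) = Y (T v)" if "Y v = scale (q powi \<mu>) v" for v \<mu>
    by (simp add: T_weight [OF that] that T.scale Y.scale mult.commute)
qed

lemma T_Yi: "T (Yi v) = Yi (T v)"
  by (metis T_Y Y_Yi Yi_Y)

text \<open>On weight \<open>\<mu>\<close> the exponents of \<open>s\<close> are \<open>- (\<mu> + 2)\<^sup>2 + 2 (\<mu> + 2)\<close> and \<open>- \<mu>\<^sup>2 - 2 \<mu>\<close>, which agree.\<close>

lemma T_Y_nz: "T (Y (nz v)) = nz (Yi (T v))"
proof (rule linear_eq_weightI [of "\<lambda>v. T (Y (nz v))" "\<lambda>v. nz (Yi (T v))"])
  show "Vector_Spaces.linear scale scale (\<lambda>v. T (Y (nz v)))"
    by (rule linear_operatorI) (simp_all add: T.add T.scale Y.add Y.scale nz.add nz.scale)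
  show "Vector_Spaces.linear scale scale (\<lambda>v. nz (Yi (T v)))"
    by (rule linear_operatorI) (simp_all add: T.add T.scale Yi.add Yi.scale nz.add nz.scale)
  fix v \<mu> assume v: "Y v = scale (q powi \<mu>) v"
  have "s powi (- ((\<mu> + 2) ^ 2)) * q powi (\<mu> + 2) = s powi (- (\<mu> ^ 2)) * q powi (- \<mu>)"
    unfolding q_powi_eq_s_powi using s_nonzero
    by (simp add: power_int_add [symmetric] del: power_int_minus power_int_add)
      (simp add: power2_eq_square algebra_simps)
  then show "T (Y (nz v)) = nz (Yi (T v))"
    by (simp add: nz_weight [OF v] T_weight [OF nz_weight [OF v]] T_weight [OF v] Yi_weight [OF v]
        T.scale Yi.scale nz.scale mult.commute)
qed

text \<open>On weight \<open>\<mu>\<close> the exponents of \<open>s\<close> are \<open>- (\<mu> - 2)\<^sup>2 - 2 (\<mu> - 2)\<close> and \<open>- \<mu>\<^sup>2 + 2 \<mu>\<close>, which agree.\<close>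

lemma T_Yi_nx: "T (Yi (nx v)) = nx (Y (T v))"
proof (rule linear_eq_weightI [of "\<lambda>v. T (Yi (nx v))" "\<lambda>v. nx (Y (T v))"])
  interpret nx: Vector_Spaces.linear scale scale nx by (rule linear_nx)
  show "Vector_Spaces.linear scale scale (\<lambda>v. T (Yi (nx v)))"
    by (rule linear_operatorI) (simp_all add: T.add T.scale Yi.add Yi.scale nx.add nx.scale)
  show "Vector_Spaces.linear scale scale (\<lambda>v. nx (Y (T v)))"
    by (rule linear_operatorI) (simp_all add: T.add T.scale Y.add Y.scale nx.add nx.scale)
  fix v \<mu> assume v: "Y v = scale (q powi \<mu>) v"
  have "s powi (- ((\<mu> - 2) ^ 2)) * q powi (- (\<mu> - 2)) = s powi (- (\<mu> ^ 2)) * q powi \<mu>"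
    unfolding q_powi_eq_s_powi using s_nonzero
    by (simp add: power_int_add [symmetric] del: power_int_minus power_int_add)
      (simp add: power2_eq_square algebra_simps)
  then show "T (Yi (nx v)) = nx (Y (T v))"
    by (simp add: Yi_weight [OF nx_weight [OF v]] T_weight [OF nx_weight [OF v]] T_weight [OF v] v
        T.scale Y.scale nx.scale mult.commute)
qed

lemma linear_rotator: "Vector_Spaces.linear scale scale (F \<circ> T \<circ> E)"
  by (intro Vector_Spaces.linear_compose [of scale scale _ scale] linear_E linear_F linear_T)

lemma bij_rotator: "bij (F \<circ> T \<circ> E)"
proof -
  have "bij E"
    by (rule o_bij [of "exp_q scale (inverse q) (\<lambda>v. - nz v)"]) (simp_all add: fun_eq_iff E_inverse)
  moreover have "bij F"
    by (rule o_bij [of dual.E]) (simp_all only: fun_eq_iff o_apply id_apply F_inverse simp_thms)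
  ultimately show ?thesis
    by (intro bij_comp bij_T)
qed

lemma rotator_Z: "Z (F (T (E v))) = F (T (E (X v)))"
  by (simp only: Z_F T_Yi E_X)

text \<open>Pushing \<open>Y\<close> through \<open>F\<close> from the left and \<open>Z\<close> through \<open>E\<close> from the right leaves
  \<open>T (Z + Y - Y\<^sup>-\<^sup>1) = Y Z Y T\<close>. Written in terms of \<open>n\<^sub>x\<close>, both sides are
  \<open>Y T - (1 - q\<^sup>-\<^sup>2) n\<^sub>x Y T\<close>.\<close>

lemma rotator_Y: "Y (F (T (E v))) = F (T (E (Z v)))"
proof -
  have "T (Z u + Y u - Yi u) = Y (Z (Y (T u)))" for u
    by (simp add: Z_eq [of u] YZ_eq T.add T.diff T.scale T_Yi_nx T_Y)
  then show ?thesis by (simp only: Y_F E_Z)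
qed

text \<open>Here the remaining identity is \<open>T Y X Y = (X + Y - Y\<^sup>-\<^sup>1) T\<close>, which in terms of \<open>n\<^sub>z\<close> has both sides
  equal to \<open>Y T - (1 - q\<^sup>-\<^sup>2) n\<^sub>z Y\<^sup>-\<^sup>1 T\<close>.\<close>

lemma rotator_X: "X (F (T (E v))) = F (T (E (Y v)))"
proof -
  have "T (Y (X (Y u))) = X (T u) + Y (T u) - Yi (T u)" for u
    using XY_eq [of "Yi (T u)"]
    by (simp add: XY_eq Y_Yi Y.diff Y.scale T.diff T.scale T_Y_nz) (simp add: T_Y)
  then show ?thesis by (simp only: X_F E_Y)
qed

end

end

section \<open>From the Chevalley to the equitable generators\<close>

text \<open>A representation of the Chevalley presentation, again with a spanning set of weight vectors. The
  powers of \<open>k\<close> form a family \<open>K\<close> indexed by the integers, which makes the involution below a mere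
  change of sign of the index.\<close>

locale chevalley_action = vector_space scale + not_root_of_unity q
  for scale :: "'f::field \<Rightarrow> 'v::ab_group_add \<Rightarrow> 'v" and q :: 'f +
  fixes K :: "int \<Rightarrow> 'v \<Rightarrow> 'v" and e f :: "'v \<Rightarrow> 'v"
  assumes linear_K: "Vector_Spaces.linear scale scale (K m)"
    and linear_e: "Vector_Spaces.linear scale scale e"
    and linear_f: "Vector_Spaces.linear scale scale f"
    and K_0: "K 0 v = v"
    and K_add: "K (m + n) v = K m (K n v)"
    and K_e: "K 1 (e v) = scale (q ^ 2) (e (K 1 v))"
    and K_f: "K 1 (f v) = scale (inverse q ^ 2) (f (K 1 v))"
    and e_f: "e (f v) - f (e v) = scale (inverse (q - inverse q)) (K 1 v - K (- 1) v)"
    and weight_spanned: "\<exists>B. finite B \<and> span B = UNIV \<and> (\<forall>b\<in>B. \<exists>\<mu>::int. K 1 b = scale (q powi \<mu>) b)"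
begin

sublocale K: Vector_Spaces.linear scale scale "K m" for m by (rule linear_K)
sublocale e: Vector_Spaces.linear scale scale e by (rule linear_e)
sublocale f: Vector_Spaces.linear scale scale f by (rule linear_f)

sublocale weighted_space scale q "K 1"
  by unfold_locales (fact K.add K.scale weight_spanned)+

lemma K_inverse: "K m (K (- m) v) = v" "K (- m) (K m v) = v"
  using K_add [of m "- m" v] K_add [of "- m" m v] by (simp_all add: K_0)

lemma K_weight:
  assumes "K 1 v = scale (q powi \<mu>) v"
  shows "K m v = scale (q powi (m * \<mu>)) v"
proof -
  have nat: "K (int n) v = scale (q powi (int n * \<mu>)) v" for n
  proof (induction n)
    case (Suc n)
    have "K (int (Suc n)) v = K (int n) (K 1 v)"
      using K_add [of "int n" 1 v] by (simp add: add.commute)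
    then show ?case
      using q_nonzero by (simp add: assms K.scale Suc power_int_add [symmetric] algebra_simps)
  qed (simp add: K_0)
  show ?thesis
  proof (cases "m \<ge> 0")
    case True
    then show ?thesis using nat [of "nat m"] by simp
  next
    case False
    then have "K (- m) v = scale (q powi (- m * \<mu>)) v"
      using nat [of "nat (- m)"] by simp
    then have "v = scale (q powi (- m * \<mu>)) (K m v)"
      using K_inverse(1) [of m v] K.scale by metis
    then have "scale (q powi (m * \<mu>)) v = scale (q powi (m * \<mu>) * q powi (- m * \<mu>)) (K m v)"
      by (metis scale_scale)
    moreover have "q powi (m * \<mu>) * q powi (- m * \<mu>) = 1"
      using q_nonzero by (simp add: power_int_add [symmetric])
    ultimately show ?thesis by simp
  qed
qed

lemma e_weight:
  assumes "K 1 v = scale (q powi \<mu>) v"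
  shows "K 1 (e v) = scale (q powi (\<mu> + 2)) (e v)"
  using q_nonzero by (simp add: K_e assms e.scale power_int_add mult.commute)

lemma f_weight:
  assumes "K 1 v = scale (q powi \<mu>) v"
  shows "K 1 (f v) = scale (q powi (\<mu> - 2)) (f v)"
  using q_nonzero by (simp add: K_f assms f.scale power_int_diff power_inverse field_simps)

text \<open>Exchanging \<open>e\<close> with \<open>f\<close> and \<open>k\<close> with \<open>k\<^sup>-\<^sup>1\<close>. It carries the formulas of the primary
  identification to those of the secondary one, with the same \<open>\<theta>\<close> and \<open>t\<close>.\<close>

lemma chevalley_involution: "chevalley_action scale q (\<lambda>m. K (- m)) f e"
proof unfold_locales
  have inv1: "K (- 1) u = w" if "K 1 w = u" for u w
    using that K_inverse(2) [of 1 w] by simp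
  show "K (- 1) (f v) = scale (q ^ 2) (f (K (- 1) v))" for v
    by (rule inv1) (use q_nonzero in \<open>simp add: K.scale K_f K_inverse power_inverse\<close>)
  show "K (- 1) (e v) = scale (inverse q ^ 2) (e (K (- 1) v))" for v
    by (rule inv1) (use q_nonzero in \<open>simp add: K.scale K_e K_inverse power_inverse\<close>)
  show "K (- (m + n)) v = K (- m) (K (- n) v)" for m n v
    using K_add [of "- m" "- n" v] by simp
  show "f (e v) - e (f v) = scale (inverse (q - inverse q)) (K (- 1) v - K (- (- 1)) v)" for v
    using arg_cong [OF e_f [of v], of uminus] by (simp add: scale_right_diff_distrib)
  obtain B where B: "finite B" "span B = UNIV" "\<forall>b\<in>B. \<exists>\<mu>::int. K 1 b = scale (q powi \<mu>) b"
    using weight_spanned by blast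
  moreover have "\<forall>b\<in>B. \<exists>\<mu>::int. K (- 1) b = scale (q powi \<mu>) b"
    using B(3) K_weight by blast
  ultimately show "\<exists>B. finite B \<and> span B = UNIV \<and> (\<forall>b\<in>B. \<exists>\<mu>::int. K (- 1) b = scale (q powi \<mu>) b)"
    by blast
qed (simp_all add: K.add K.scale e.add e.scale f.add f.scale K_0)

definition equitable_x :: "'f \<Rightarrow> int \<Rightarrow> 'v \<Rightarrow> 'v" where
  "equitable_x \<theta> t v =
     K (- 1) v - K (- 1 - t) (e (scale (q powi (1 + t) * (q - inverse q) * inverse \<theta>) v))"

definition equitable_z :: "'f \<Rightarrow> int \<Rightarrow> 'v \<Rightarrow> 'v" where
  "equitable_z \<theta> t v =
     K (- 1) v + f (K t (scale (q powi (- t) * (q - inverse q) * \<theta>) v))"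

lemma mult_outer_factors:
  fixes a b c d i :: 'f
  assumes "a * b = c"
  shows "a * d * i * b = c * d * i"
proof -
  have "a * d * i * b = (a * b) * d * i" by (simp only: ac_simps)
  then show ?thesis by (simp only: assms)
qed

lemma mult_inner_factor:
  fixes a b c d x :: 'f
  assumes "a * b = c * d"
  shows "a * (b * x) = c * (x * d)"
proof -
  have "a * (b * x) = (a * b) * x" "c * (x * d) = (c * d) * x" by (simp_all only: ac_simps)
  then show ?thesis by (simp only: assms)
qed

lemma q_powi_add: "q powi a * q powi b = q powi (a + b)"
  using q_nonzero by (simp add: power_int_add)

lemma linear_equitable_x: "Vector_Spaces.linear scale scale (equitable_x \<theta> t)"
  by (rule linear_operatorI)
    (simp_all add: equitable_x_def K.add K.scale e.add e.scale scale_right_distrib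
      scale_right_diff_distrib mult.commute)

lemma linear_equitable_z: "Vector_Spaces.linear scale scale (equitable_z \<theta> t)"
  by (rule linear_operatorI)
    (simp_all add: equitable_z_def K.add K.scale f.add f.scale scale_right_distrib mult.commute)

text \<open>On a weight vector all powers of \<open>k\<close> become scalars, and the exponents of \<open>q\<close> combine into one.\<close>

lemma equitable_x_weight:
  assumes "K 1 v = scale (q powi \<mu>) v"
  shows "equitable_x \<theta> t v =
    scale (q powi (- \<mu>)) v - scale (q powi (- ((1 + t) * (\<mu> + 1))) * (q - inverse q) * inverse \<theta>) (e v)"
proof -
  have "K (- 1) v = scale (q powi (- \<mu>)) v"
    using K_weight [OF assms, of "- 1"] by simp
  moreover have "K (- 1 - t) (e v) = scale (q powi ((- 1 - t) * (\<mu> + 2))) (e v)"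
    by (rule K_weight [OF e_weight [OF assms]])
  moreover have "q powi (1 + t) * q powi ((- 1 - t) * (\<mu> + 2)) = q powi (- ((1 + t) * (\<mu> + 1)))"
    unfolding q_powi_add by (rule arg_cong [where f = "power_int q"]) (simp add: algebra_simps)
  then have "q powi (1 + t) * (q - inverse q) * inverse \<theta> * q powi ((- 1 - t) * (\<mu> + 2)) =
      q powi (- ((1 + t) * (\<mu> + 1))) * (q - inverse q) * inverse \<theta>"
    by (rule mult_outer_factors)
  ultimately show ?thesis
    by (simp add: equitable_x_def e.scale K.scale)
qed

lemma equitable_z_weight:
  assumes "K 1 v = scale (q powi \<mu>) v"
  shows "equitable_z \<theta> t v =
    scale (q powi (- \<mu>)) v + scale (q powi (t * (\<mu> - 1)) * (q - inverse q) * \<theta>) (f v)"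
proof -
  have "K (- 1) v = scale (q powi (- \<mu>)) v"
    using K_weight [OF assms, of "- 1"] by simp
  moreover have "K t v = scale (q powi (t * \<mu>)) v"
    by (rule K_weight [OF assms])
  moreover have "q powi (- t) * q powi (t * \<mu>) = q powi (t * (\<mu> - 1))"
    unfolding q_powi_add by (rule arg_cong [where f = "power_int q"]) (simp add: algebra_simps)
  then have "q powi (- t) * (q - inverse q) * \<theta> * q powi (t * \<mu>) =
      q powi (t * (\<mu> - 1)) * (q - inverse q) * \<theta>"
    by (rule mult_outer_factors)
  ultimately show ?thesis
    by (simp add: equitable_z_def f.scale K.scale)
qed

text \<open>Each relation is verified on a vector of weight \<open>\<mu>\<close>. In the relation between \<open>z\<close> and \<open>x\<close> the
  multiples of \<open>e v\<close> and \<open>f v\<close> cancel, the parameters \<open>t\<close> and \<open>\<theta>\<close> disappear from the coefficients of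
  \<open>e f v\<close> and \<open>f e v\<close>, which become equal, and the commutator of \<open>e\<close> and \<open>f\<close> supplies what is missing from
  \<open>(q - q\<^sup>-\<^sup>1) v\<close>.\<close>

lemma equitable_action_chevalley:
  assumes "\<theta> \<noteq> 0"
  shows "equitable_action scale q (K 1) (equitable_x \<theta> t) (K (- 1)) (equitable_z \<theta> t)"
proof (intro equitable_action.intro equitable_action_axioms.intro weighted_space_axioms
    linear_K linear_equitable_x linear_equitable_z K_inverse)
  let ?X = "equitable_x \<theta> t" and ?Z = "equitable_z \<theta> t" and ?d = "q - inverse q"
  interpret X: Vector_Spaces.linear scale scale ?X by (rule linear_equitable_x)
  interpret Z: Vector_Spaces.linear scale scale ?Z by (rule linear_equitable_z)
  have pow: "q * q powi a = q powi (a + 1)" "inverse q * q powi a = q powi (a - 1)" for a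
    using q_nonzero by (simp_all add: power_int_add power_int_diff field_simps)
  have lin: "Vector_Spaces.linear scale scale (\<lambda>v. scale a (S (T v)) - scale b (T (S v)))"
    if "Vector_Spaces.linear scale scale S" "Vector_Spaces.linear scale scale T" for a b S T
  proof -
    interpret S: Vector_Spaces.linear scale scale S by fact
    interpret T: Vector_Spaces.linear scale scale T by fact
    show ?thesis
      by (rule linear_operatorI)
        (simp_all add: S.add S.scale T.add T.scale scale_right_distrib scale_right_diff_distrib mult.commute)
  qed
  have lin_scale: "Vector_Spaces.linear scale scale (scale c)" for c
    by (rule linear_operatorI) (simp_all add: scale_right_distrib mult.commute)
  show "scale q (?X (K 1 v)) - scale (inverse q) (K 1 (?X v)) = scale ?d v" for v
  proof (rule linear_eq_weightI [OF lin [OF linear_equitable_x linear_K] lin_scale])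
    fix v \<mu> assume v: "K 1 v = scale (q powi \<mu>) v"
    let ?\<alpha> = "q powi (- ((1 + t) * (\<mu> + 1))) * ?d * inverse \<theta>" and ?w = "q powi (- \<mu>)"
    have XY: "?X (K 1 v) = scale (q powi \<mu> * ?w) v - scale (q powi \<mu> * ?\<alpha>) (e v)"
      by (simp only: v X.scale equitable_x_weight [OF v] scale_right_diff_distrib scale_scale)
    have YX: "K 1 (?X v) = scale (q powi \<mu> * ?w) v - scale (q powi (\<mu> + 2) * ?\<alpha>) (e v)"
      by (simp only: equitable_x_weight [OF v] K.diff K.scale v e_weight [OF v] scale_scale mult.commute)
    have "q * q powi \<mu> = inverse q * q powi (\<mu> + 2)"
      unfolding pow by (rule arg_cong [where f = "power_int q"]) simp
    then have e: "q * (q powi \<mu> * ?\<alpha>) = inverse q * (q powi (\<mu> + 2) * ?\<alpha>)"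
      by (simp only: mult.assoc [symmetric])
    show "scale q (?X (K 1 v)) - scale (inverse q) (K 1 (?X v)) = scale ?d v"
      unfolding XY YX scale_right_diff_distrib scale_scale e
      by (simp add: q_powi_add scale_left_diff_distrib)
  qed
  show "scale q (K 1 (?Z v)) - scale (inverse q) (?Z (K 1 v)) = scale ?d v" for v
  proof (rule linear_eq_weightI [OF lin [OF linear_K linear_equitable_z] lin_scale])
    fix v \<mu> assume v: "K 1 v = scale (q powi \<mu>) v"
    let ?\<beta> = "q powi (t * (\<mu> - 1)) * ?d * \<theta>" and ?w = "q powi (- \<mu>)"
    have YZ: "K 1 (?Z v) = scale (q powi \<mu> * ?w) v + scale (q powi (\<mu> - 2) * ?\<beta>) (f v)"
      by (simp only: equitable_z_weight [OF v] K.add K.scale v f_weight [OF v] scale_scale mult.commute)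
    have ZY: "?Z (K 1 v) = scale (q powi \<mu> * ?w) v + scale (q powi \<mu> * ?\<beta>) (f v)"
      by (simp only: v Z.scale equitable_z_weight [OF v] scale_right_distrib scale_scale)
    have "q * q powi (\<mu> - 2) = inverse q * q powi \<mu>"
      unfolding pow by (rule arg_cong [where f = "power_int q"]) simp
    then have f: "q * (q powi (\<mu> - 2) * ?\<beta>) = inverse q * (q powi \<mu> * ?\<beta>)"
      by (simp only: mult.assoc [symmetric])
    show "scale q (K 1 (?Z v)) - scale (inverse q) (?Z (K 1 v)) = scale ?d v"
      unfolding YZ ZY scale_right_distrib scale_scale f
      by (simp add: q_powi_add scale_left_diff_distrib)
  qed
  show "scale q (?Z (?X v)) - scale (inverse q) (?X (?Z v)) = scale ?d v" for v
  proof (rule linear_eq_weightI [OF lin [OF linear_equitable_z linear_equitable_x] lin_scale])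
    fix v \<mu> assume v: "K 1 v = scale (q powi \<mu>) v"
    let ?\<alpha> = "\<lambda>\<mu>. q powi (- ((1 + t) * (\<mu> + 1))) * ?d * inverse \<theta>"
      and ?\<beta> = "\<lambda>\<mu>. q powi (t * (\<mu> - 1)) * ?d * \<theta>" and ?w = "q powi (- \<mu>)"
    have ZX: "?Z (?X v) = scale (?w * ?w) v + scale (?w * ?\<beta> \<mu>) (f v)
        - scale (?\<alpha> \<mu> * q powi (- (\<mu> + 2))) (e v) - scale (?\<alpha> \<mu> * ?\<beta> (\<mu> + 2)) (f (e v))"
      by (simp only: equitable_x_weight [OF v] Z.diff Z.scale equitable_z_weight [OF v]
          equitable_z_weight [OF e_weight [OF v]] scale_right_distrib scale_scale) simp
    have XZ: "?X (?Z v) = scale (?w * ?w) v - scale (?w * ?\<alpha> \<mu>) (e v)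
        + scale (?\<beta> \<mu> * q powi (- (\<mu> - 2))) (f v) - scale (?\<beta> \<mu> * ?\<alpha> (\<mu> - 2)) (e (f v))"
      by (simp only: equitable_z_weight [OF v] X.add X.scale equitable_x_weight [OF v]
          equitable_x_weight [OF f_weight [OF v]] scale_right_diff_distrib scale_scale) simp
    have fv: "q * (?w * ?\<beta> \<mu>) = inverse q * (?\<beta> \<mu> * q powi (- (\<mu> - 2)))"
    proof -
      have "q * ?w = inverse q * q powi (- (\<mu> - 2))"
        unfolding pow by (rule arg_cong [where f = "power_int q"]) simp
      then show ?thesis by (rule mult_inner_factor)
    qed
    have ev: "q * (?\<alpha> \<mu> * q powi (- (\<mu> + 2))) = inverse q * (?w * ?\<alpha> \<mu>)"
    proof -
      have "inverse q * ?w = q * q powi (- (\<mu> + 2))"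
        unfolding pow by (rule arg_cong [where f = "power_int q"]) simp
      then show ?thesis by (rule mult_inner_factor [symmetric])
    qed
    have ab: "?\<alpha> \<mu> * ?\<beta> \<nu> = q powi (- ((1 + t) * (\<mu> + 1)) + t * (\<nu> - 1)) * ?d * ?d" for \<mu> \<nu>
    proof -
      have "a * d * i * (b * d * \<theta>) = a * b * d * d * (i * \<theta>)" for a b d i :: 'f
        by (simp only: ac_simps)
      then show ?thesis
        unfolding q_powi_add [symmetric] using left_inverse [OF assms] by simp
    qed
    \<comment> \<open>The exponents of \<open>q\<close> coming from \<open>t\<close> cancel here and in the next step.\<close>
    have fe: "q * (?\<alpha> \<mu> * ?\<beta> (\<mu> + 2)) = ?w * ?d * ?d"
    proof -
      have "- ((1 + t) * (\<mu> + 1)) + t * (\<mu> + 2 - 1) + 1 = - \<mu>" by (simp add: algebra_simps)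
      then show ?thesis
        by (simp only: ab) (simp only: mult.assoc [symmetric] pow)
    qed
    have ef: "inverse q * (?\<beta> \<mu> * ?\<alpha> (\<mu> - 2)) = ?w * ?d * ?d"
    proof -
      have "- ((1 + t) * (\<mu> - 2 + 1)) + t * (\<mu> - 1) - 1 = - \<mu>" by (simp add: algebra_simps)
      then show ?thesis
        by (simp only: mult.commute [of "?\<beta> \<mu>"] ab) (simp only: mult.assoc [symmetric] pow)
    qed
    have "scale q (?Z (?X v)) - scale (inverse q) (?X (?Z v)) =
        scale (?d * ?w * ?w) v + scale (?w * ?d * ?d) (e (f v) - f (e v))"
      unfolding ZX XZ scale_right_distrib scale_right_diff_distrib scale_scale fv ev fe ef
      by (simp add: left_diff_distrib scale_left_diff_distrib mult.assoc)
    also have "scale (?w * ?d * ?d) (e (f v) - f (e v)) = scale (?w * ?d * (q powi \<mu> - ?w)) v"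
      using K_weight [OF v, of "- 1"] q_minus_inverse_neq_0
      by (simp add: e_f v scale_left_diff_distrib [symmetric])
    also have "scale (?d * ?w * ?w) v + \<dots> = scale (?d * (?w * q powi \<mu>)) v"
      unfolding scale_left_distrib [symmetric]
      by (rule arg_cong [where f = "\<lambda>c. scale c v"]) (simp add: algebra_simps)
    also have "\<dots> = scale ?d v"
      unfolding q_powi_add by simp
    finally show "scale q (?Z (?X v)) - scale (inverse q) (?X (?Z v)) = scale ?d v" .
  qed
qed

end

section \<open>The algebra given by generators and relations\<close>

lemma free_ring_ring: "ring (free_ring :: ('g, 'f::field) free_alg ring)"
proof (rule ringI)
  show "abelian_group (free_ring :: ('g, 'f) free_alg ring)"
  proof (rule abelian_groupI)
    show "\<exists>b\<in>carrier free_ring. b \<oplus>\<^bsub>free_ring\<^esub> a = \<zero>\<^bsub>free_ring\<^esub>" for a :: "('g, 'f) free_alg"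
      by (intro bexI [of _ "- a"]) (simp_all add: free_ring_def)
  qed (simp_all add: free_ring_def ac_simps)
  show "Group.monoid (free_ring :: ('g, 'f) free_alg ring)"
    by unfold_locales (simp_all add: free_ring_def ac_simps)
qed (simp_all add: free_ring_def algebra_simps)

lemma presented_ideal: "ideal (Idl\<^bsub>free_ring\<^esub> rels) (free_ring :: ('g, 'f::field) free_alg ring)"
  by (rule ring.genideal_ideal [OF free_ring_ring]) (simp add: free_ring_def)

lemma presented_alg_ring: "ring (presented_alg rels)"
  unfolding presented_alg_def by (rule ideal.quotient_is_ring [OF presented_ideal])

lemma presented_class_hom: "presented_class rels \<in> ring_hom free_ring (presented_alg rels)"
  using ideal.rcos_ring_hom [OF presented_ideal]
  by (simp add: presented_class_def [abs_def] presented_alg_def)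

lemma presented_class_closed: "presented_class rels a \<in> carrier (presented_alg rels)"
  using ring_hom_closed [OF presented_class_hom] by (simp add: free_ring_def)

lemma presented_class_add:
  "presented_class rels (a + b) = presented_class rels a \<oplus>\<^bsub>presented_alg rels\<^esub> presented_class rels b"
  using ring_hom_add [OF presented_class_hom, of a b] by (simp add: free_ring_def)

lemma presented_class_mult:
  "presented_class rels (a * b) = presented_class rels a \<otimes>\<^bsub>presented_alg rels\<^esub> presented_class rels b"
  using ring_hom_mult [OF presented_class_hom, of a b] by (simp add: free_ring_def)

lemma presented_class_1: "presented_class rels 1 = \<one>\<^bsub>presented_alg rels\<^esub>"
  using ring_hom_one [OF presented_class_hom] by (simp add: free_ring_def)

text \<open>How a defining relation is used: it lies in the ideal, so its class is zero.\<close>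

lemma presented_class_eqI:
  assumes "a - b \<in> rels"
  shows "presented_class rels a = presented_class rels b"
proof -
  interpret I: ideal "Idl\<^bsub>free_ring\<^esub> rels" free_ring by (rule presented_ideal)
  interpret P: ring "presented_alg rels" by (rule presented_alg_ring)
  have "a - b \<in> Idl\<^bsub>free_ring\<^esub> rels"
    using ring.genideal_self [OF free_ring_ring, of rels] assms by (auto simp: free_ring_def)
  then have "presented_class rels (a - b) = \<zero>\<^bsub>presented_alg rels\<^esub>"
    by (simp add: presented_class_def presented_alg_def FactRing_def I.a_rcos_const)
  then show ?thesis
    using presented_class_add [of rels "a - b" b] presented_class_closed [of rels b] by simp
qed

lemma Uq_ring: "ring (Uq q)"
  unfolding Uq_def by (rule presented_alg_ring)

definition uq_kinv :: "'f::field \<Rightarrow> 'f uq" where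
  "uq_kinv q = presented_class (uq_relations q) (free_gen GKinv)"

lemma Uq_closed:
  "uq_scalar q c \<in> carrier (Uq q)" "uq_e q \<in> carrier (Uq q)" "uq_f q \<in> carrier (Uq q)"
  "uq_k q \<in> carrier (Uq q)" "uq_kinv q \<in> carrier (Uq q)"
  by (simp_all add: uq_scalar_def uq_e_def uq_f_def uq_k_def uq_kinv_def Uq_def presented_class_closed)

text \<open>In the last relation the difference \<open>k - k\<^sup>-\<^sup>1\<close> appears as an element \<open>d\<close> with \<open>d + k\<^sup>-\<^sup>1 = k\<close>,
  because a module is described by its compatibility with sums and products.\<close>

lemma Uq_relations:
  shows "uq_k q \<otimes>\<^bsub>Uq q\<^esub> uq_kinv q = \<one>\<^bsub>Uq q\<^esub>"
    and "uq_kinv q \<otimes>\<^bsub>Uq q\<^esub> uq_k q = \<one>\<^bsub>Uq q\<^esub>"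
    and "uq_k q \<otimes>\<^bsub>Uq q\<^esub> uq_e q = uq_scalar q (q ^ 2) \<otimes>\<^bsub>Uq q\<^esub> uq_e q \<otimes>\<^bsub>Uq q\<^esub> uq_k q"
    and "uq_k q \<otimes>\<^bsub>Uq q\<^esub> uq_f q = uq_scalar q (inverse q ^ 2) \<otimes>\<^bsub>Uq q\<^esub> uq_f q \<otimes>\<^bsub>Uq q\<^esub> uq_k q"
    and "\<exists>d\<in>carrier (Uq q). d \<oplus>\<^bsub>Uq q\<^esub> uq_kinv q = uq_k q \<and>
      uq_e q \<otimes>\<^bsub>Uq q\<^esub> uq_f q = uq_f q \<otimes>\<^bsub>Uq q\<^esub> uq_e q
        \<oplus>\<^bsub>Uq q\<^esub> uq_scalar q (inverse (q - inverse q)) \<otimes>\<^bsub>Uq q\<^esub> d"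
proof -
  let ?c = "presented_class (uq_relations q)"
  let ?e = "free_gen GE :: (uq_gen, 'a) free_alg" and ?f = "free_gen GF :: (uq_gen, 'a) free_alg"
    and ?k = "free_gen GK :: (uq_gen, 'a) free_alg" and ?ki = "free_gen GKinv :: (uq_gen, 'a) free_alg"
  note defs = uq_scalar_def uq_e_def uq_f_def uq_k_def uq_kinv_def Uq_def
    presented_class_mult [symmetric] presented_class_add [symmetric] presented_class_1 [symmetric]
  show "uq_k q \<otimes>\<^bsub>Uq q\<^esub> uq_kinv q = \<one>\<^bsub>Uq q\<^esub>" "uq_kinv q \<otimes>\<^bsub>Uq q\<^esub> uq_k q = \<one>\<^bsub>Uq q\<^esub>"
    "uq_k q \<otimes>\<^bsub>Uq q\<^esub> uq_e q = uq_scalar q (q ^ 2) \<otimes>\<^bsub>Uq q\<^esub> uq_e q \<otimes>\<^bsub>Uq q\<^esub> uq_k q"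
    "uq_k q \<otimes>\<^bsub>Uq q\<^esub> uq_f q = uq_scalar q (inverse q ^ 2) \<otimes>\<^bsub>Uq q\<^esub> uq_f q \<otimes>\<^bsub>Uq q\<^esub> uq_k q"
    unfolding defs by (rule presented_class_eqI; simp add: uq_relations_def Let_def)+
  \<comment> \<open>Regrouping the last relation as one difference gives it the shape that \<open>presented_class_eqI\<close> expects.\<close>
  have "?e * ?f - (?f * ?e + free_scalar (inverse (q - inverse q)) * (?k - ?ki)) \<in> uq_relations q"
    unfolding diff_diff_eq [symmetric] by (simp add: uq_relations_def Let_def)
  then have "?c (?e * ?f) = ?c (?f * ?e + free_scalar (inverse (q - inverse q)) * (?k - ?ki))"
    by (rule presented_class_eqI)
  moreover have "?c (?k - ?ki) \<in> carrier (Uq q)"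
    by (simp add: Uq_def presented_class_closed)
  moreover have "?c ((?k - ?ki) + ?ki) = ?c ?k"
    by simp
  ultimately show "\<exists>d\<in>carrier (Uq q). d \<oplus>\<^bsub>Uq q\<^esub> uq_kinv q = uq_k q \<and>
      uq_e q \<otimes>\<^bsub>Uq q\<^esub> uq_f q = uq_f q \<otimes>\<^bsub>Uq q\<^esub> uq_e q
        \<oplus>\<^bsub>Uq q\<^esub> uq_scalar q (inverse (q - inverse q)) \<otimes>\<^bsub>Uq q\<^esub> d"
    unfolding uq_scalar_def uq_e_def uq_f_def uq_k_def uq_kinv_def Uq_def
      presented_class_mult presented_class_add by blast
qed

lemma uq_k_unit: "uq_k q \<in> Units (Uq q)"
  using Uq_relations(1,2) [of q] Uq_closed [of q] by (auto simp: Units_def)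

text \<open>Transfers the laws of exponents from the group of units to the integer powers of a unit, whose
  negative powers are formed with inverses in the monoid.\<close>

lemma (in monoid) Units_int_pow:
  assumes "x \<in> Units G"
  shows "x [^] (m::int) = x [^]\<^bsub>units_of G\<^esub> m"
proof -
  interpret U: group "units_of G" by (rule units_group)
  have nat: "x [^] (n::nat) = x [^]\<^bsub>units_of G\<^esub> n" for n
    by (induction n) (simp_all add: units_of_def)
  have "inv (x [^] (n::nat)) = inv\<^bsub>units_of G\<^esub> (x [^]\<^bsub>units_of G\<^esub> n)" for n
    unfolding nat using U.nat_pow_closed [of x n] assms
    by (intro units_of_inv [symmetric]) (simp only: units_of_carrier)
  then show ?thesis by (simp only: int_pow_def2 nat)
qed

lemma
  shows uq_kpow_closed: "uq_kpow q m \<in> carrier (Uq q)"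
    and uq_kpow_0: "uq_kpow q 0 = \<one>\<^bsub>Uq q\<^esub>"
    and uq_kpow_1: "uq_kpow q 1 = uq_k q"
    and uq_kpow_add: "uq_kpow q (m + n) = uq_kpow q m \<otimes>\<^bsub>Uq q\<^esub> uq_kpow q n"
    and uq_kpow_minus_1: "uq_kpow q (- 1) = uq_kinv q"
proof -
  interpret U: ring "Uq q" by (rule Uq_ring)
  interpret G: group "units_of (Uq q)" by (rule U.units_group)
  have k: "uq_k q \<in> carrier (units_of (Uq q))"
    using uq_k_unit by (simp add: units_of_def)
  have pow: "uq_kpow q m = uq_k q [^]\<^bsub>units_of (Uq q)\<^esub> m" for m
    unfolding uq_kpow_def by (rule U.Units_int_pow [OF uq_k_unit])
  show "uq_kpow q m \<in> carrier (Uq q)"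
    using G.int_pow_closed [OF k, of m] by (simp add: pow units_of_def U.Units_closed)
  show "uq_kpow q 0 = \<one>\<^bsub>Uq q\<^esub>"
    by (simp add: uq_kpow_def)
  show "uq_kpow q 1 = uq_k q"
    using k by (simp add: pow)
  show "uq_kpow q (m + n) = uq_kpow q m \<otimes>\<^bsub>Uq q\<^esub> uq_kpow q n"
    using G.int_pow_mult [OF k, of m n] by (simp add: pow units_of_def)
  have "inv\<^bsub>Uq q\<^esub> (uq_k q) = uq_kinv q"
    using U.inv_char [of "uq_k q" "uq_kinv q"] Uq_relations(1,2) [of q] Uq_closed [of q] by simp
  then show "uq_kpow q (- 1) = uq_kinv q"
    using Uq_closed(4) [of q] by (simp add: uq_kpow_def int_pow_def2)
qed

section \<open>Modules of type 1\<close>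

text \<open>The bases of the irreducible summands, taken together, span the module and consist of weight
  vectors.\<close>

lemma type1_weight_spanned:
  assumes mod: "uq_module scale q \<rho>" and "type1 scale q \<rho>"
  shows "\<exists>B. finite B \<and> module.span scale B = UNIV \<and>
    (\<forall>b\<in>B. \<exists>\<mu>::int. \<rho> (uq_k q) b = scale (q powi \<mu>) b)"
proof -
  interpret vector_space scale using mod by (simp add: uq_module_def)
  obtain n :: nat and W where W: "\<forall>i<n. \<exists>d. is_copy_of_Vd scale q \<rho> d (W i)"
    and sum: "\<forall>v. \<exists>!w. w \<in> (\<Pi>\<^sub>E i\<in>{..<n}. W i) \<and> v = (\<Sum>i<n. w i)"
    using assms(2) unfolding type1_def by blast
  have "\<exists>C. finite C \<and> span C = W i \<and> (\<forall>b\<in>C. \<exists>\<mu>::int. \<rho> (uq_k q) b = scale (q powi \<mu>) b)"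
    if i: "i < n" for i
  proof -
    obtain d where "is_copy_of_Vd scale q \<rho> d (W i)"
      using W i by blast
    then obtain v where "span (v ` {0..d}) = W i"
      and "\<forall>j\<le>d. \<rho> (uq_k q) (v j) = scale (q powi (int d - 2 * int j)) (v j)"
      unfolding is_copy_of_Vd_def by (elim conjE exE) blast
    then show ?thesis
      by (intro exI [of _ "v ` {0..d}"]) auto
  qed
  then obtain C where C: "\<And>i. i < n \<Longrightarrow> finite (C i) \<and> span (C i) = W i \<and>
      (\<forall>b\<in>C i. \<exists>\<mu>::int. \<rho> (uq_k q) b = scale (q powi \<mu>) b)"
    by metis
  let ?B = "\<Union>i<n. C i"
  have "v \<in> span ?B" for v
  proof -
    obtain w where w: "w \<in> (\<Pi>\<^sub>E i\<in>{..<n}. W i)" "v = (\<Sum>i<n. w i)"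
      using sum by blast
    have "w i \<in> span ?B" if "i < n" for i
    proof -
      have "w i \<in> span (C i)" using w(1) C that by (auto simp: PiE_iff)
      moreover have "span (C i) \<subseteq> span ?B" using that by (intro span_mono) auto
      ultimately show ?thesis by blast
    qed
    then show ?thesis unfolding w(2) by (intro span_sum) auto
  qed
  then show ?thesis using C by (intro exI [of _ ?B]) auto
qed

lemma uq_module_chevalley_action:
  assumes mod: "uq_module scale q \<rho>" and "type1 scale q \<rho>" and "not_root_of_unity q"
  shows "chevalley_action scale q (\<lambda>m. \<rho> (uq_kpow q m)) (\<rho> (uq_e q)) (\<rho> (uq_f q))"
proof -
  interpret vector_space scale using mod by (simp add: uq_module_def)
  interpret U: ring "Uq q" by (rule Uq_ring)
  have lin: "a \<in> carrier (Uq q) \<Longrightarrow> Vector_Spaces.linear scale scale (\<rho> a)"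
    and add: "a \<in> carrier (Uq q) \<Longrightarrow> b \<in> carrier (Uq q) \<Longrightarrow> \<rho> (a \<oplus>\<^bsub>Uq q\<^esub> b) v = \<rho> a v + \<rho> b v"
    and mult: "a \<in> carrier (Uq q) \<Longrightarrow> b \<in> carrier (Uq q) \<Longrightarrow> \<rho> (a \<otimes>\<^bsub>Uq q\<^esub> b) v = \<rho> a (\<rho> b v)"
    and scalar: "\<rho> (uq_scalar q c) v = scale c v"
    and one: "\<rho> \<one>\<^bsub>Uq q\<^esub> v = v" for a b v c
    using mod by (simp_all add: uq_module_def)
  note closed = Uq_closed [of q] uq_kpow_closed [of q]
  show ?thesis
  proof (intro chevalley_action.intro chevalley_action_axioms.intro vector_space_axioms assms(3) lin closed)
    show "\<rho> (uq_kpow q 0) v = v" for v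
      by (simp add: uq_kpow_0 one)
    show "\<rho> (uq_kpow q (m + n)) v = \<rho> (uq_kpow q m) (\<rho> (uq_kpow q n) v)" for m n v
      by (simp add: uq_kpow_add mult closed)
    show "\<rho> (uq_kpow q 1) (\<rho> (uq_e q) v) = scale (q ^ 2) (\<rho> (uq_e q) (\<rho> (uq_kpow q 1) v))" for v
      using arg_cong [OF Uq_relations(3) [of q], of "\<lambda>a. \<rho> a v"]
      by (simp add: uq_kpow_1 mult closed scalar)
    show "\<rho> (uq_kpow q 1) (\<rho> (uq_f q) v) = scale (inverse q ^ 2) (\<rho> (uq_f q) (\<rho> (uq_kpow q 1) v))" for v
      using arg_cong [OF Uq_relations(4) [of q], of "\<lambda>a. \<rho> a v"]
      by (simp add: uq_kpow_1 mult closed scalar)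
    show "\<rho> (uq_e q) (\<rho> (uq_f q) v) - \<rho> (uq_f q) (\<rho> (uq_e q) v) =
      scale (inverse (q - inverse q)) (\<rho> (uq_kpow q 1) v - \<rho> (uq_kpow q (- 1)) v)" for v
    proof -
      obtain d where d: "d \<in> carrier (Uq q)" "d \<oplus>\<^bsub>Uq q\<^esub> uq_kinv q = uq_k q"
        and ef: "uq_e q \<otimes>\<^bsub>Uq q\<^esub> uq_f q = uq_f q \<otimes>\<^bsub>Uq q\<^esub> uq_e q
          \<oplus>\<^bsub>Uq q\<^esub> uq_scalar q (inverse (q - inverse q)) \<otimes>\<^bsub>Uq q\<^esub> d"
        using Uq_relations(5) [of q] by blast
      have "\<rho> d v + \<rho> (uq_kinv q) v = \<rho> (uq_k q) v"
        using arg_cong [OF d(2), of "\<lambda>a. \<rho> a v"] by (simp add: add d(1) closed)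
      then have "\<rho> d v = \<rho> (uq_kpow q 1) v - \<rho> (uq_kpow q (- 1)) v"
        by (simp add: uq_kpow_1 uq_kpow_minus_1 algebra_simps)
      moreover have "\<rho> (uq_e q) (\<rho> (uq_f q) v) =
          \<rho> (uq_f q) (\<rho> (uq_e q) v) + scale (inverse (q - inverse q)) (\<rho> d v)"
        using arg_cong [OF ef, of "\<lambda>a. \<rho> a v"] by (simp add: add mult closed d(1) scalar)
      ultimately show ?thesis by simp
    qed
    show "\<exists>B. finite B \<and> span B = UNIV \<and> (\<forall>b\<in>B. \<exists>\<mu>::int. \<rho> (uq_kpow q 1) b = scale (q powi \<mu>) b)"
      unfolding uq_kpow_1 by (rule type1_weight_spanned [OF assms(1,2)])
  qed
qed

text \<open>The definite description is justified: \<open>weight_operator_exists\<close> gives existence, and two linear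
  operators that agree on all weight vectors are equal.\<close>

lemma (in chevalley_action) Upsilon_weight:
  assumes "\<rho> (uq_k q) = K 1"
  shows "Vector_Spaces.linear scale scale (Upsilon scale q \<rho> s)"
    and "K 1 v = scale (q powi \<mu>) v \<Longrightarrow> Upsilon scale q \<rho> s v = scale (s powi (- (\<mu> ^ 2))) v"
proof -
  let ?P = "\<lambda>T. Vector_Spaces.linear scale scale T \<and>
     (\<forall>\<mu>. \<forall>v\<in>weight_space scale q \<rho> \<mu>. T v = scale (s powi (- (\<mu> ^ 2))) v)"
  obtain T where T: "?P T"
    using weight_operator_exists [of "\<lambda>\<mu>. s powi (- (\<mu> ^ 2))"]
    by (auto simp: weight_space_def assms)
  have "S = T" if S: "?P S" for S
  proof (rule ext)
    show "S v = T v" for v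
    proof (rule linear_eq_weightI [of S T])
      fix v \<mu> assume "K 1 v = scale (q powi \<mu>) v"
      then have "v \<in> weight_space scale q \<rho> \<mu>"
        by (simp add: weight_space_def assms)
      with S T have "S v = scale (s powi (- (\<mu> ^ 2))) v" "T v = scale (s powi (- (\<mu> ^ 2))) v"
        by blast+
      then show "S v = T v" by simp
    qed (use S T in simp_all)
  qed
  with T have "?P (Upsilon scale q \<rho> s)"
    unfolding Upsilon_def by (rule theI)
  then show "Vector_Spaces.linear scale scale (Upsilon scale q \<rho> s)"
    and "K 1 v = scale (q powi \<mu>) v \<Longrightarrow> Upsilon scale q \<rho> s v = scale (s powi (- (\<mu> ^ 2))) v"
    by (auto simp: weight_space_def assms)
qed

lemma eq_closed:
  "eq_x idt q \<theta> t \<in> carrier (Uq q)" "eq_y idt q \<theta> t \<in> carrier (Uq q)" "eq_z idt q \<theta> t \<in> carrier (Uq q)"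
proof -
  interpret U: ring "Uq q" by (rule Uq_ring)
  show "eq_x idt q \<theta> t \<in> carrier (Uq q)" "eq_y idt q \<theta> t \<in> carrier (Uq q)"
    "eq_z idt q \<theta> t \<in> carrier (Uq q)"
    by (cases idt; simp add: Uq_closed uq_kpow_closed)+
qed

lemma uq_module_minus:
  assumes "uq_module scale q \<rho>" "a \<in> carrier (Uq q)" "b \<in> carrier (Uq q)"
  shows "\<rho> (a \<ominus>\<^bsub>Uq q\<^esub> b) v = \<rho> a v - \<rho> b v"
proof -
  interpret U: ring "Uq q" by (rule Uq_ring)
  have "(a \<ominus>\<^bsub>Uq q\<^esub> b) \<oplus>\<^bsub>Uq q\<^esub> b = a"
    using assms(2,3) by (simp add: a_minus_def U.a_assoc U.l_neg)
  moreover have "\<rho> ((a \<ominus>\<^bsub>Uq q\<^esub> b) \<oplus>\<^bsub>Uq q\<^esub> b) v = \<rho> (a \<ominus>\<^bsub>Uq q\<^esub> b) v + \<rho> b v"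
    using assms by (simp add: uq_module_def)
  ultimately show ?thesis by (simp add: algebra_simps)
qed

lemma uq_module_equitable_nil:
  assumes "uq_module scale q \<rho>" "a \<in> carrier (Uq q)" "b \<in> carrier (Uq q)"
  shows "\<rho> (uq_scalar q (q / (q - inverse q)) \<otimes>\<^bsub>Uq q\<^esub> (\<one>\<^bsub>Uq q\<^esub> \<ominus>\<^bsub>Uq q\<^esub> (a \<otimes>\<^bsub>Uq q\<^esub> b))) =
    equitable_nil scale q (\<rho> a) (\<rho> b)"
proof -
  interpret U: ring "Uq q" by (rule Uq_ring)
  have mult: "c \<in> carrier (Uq q) \<Longrightarrow> d \<in> carrier (Uq q) \<Longrightarrow> \<rho> (c \<otimes>\<^bsub>Uq q\<^esub> d) v = \<rho> c (\<rho> d v)"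
    and scalar: "\<rho> (uq_scalar q x) v = scale x v" and one: "\<rho> \<one>\<^bsub>Uq q\<^esub> v = v" for c d v x
    using assms(1) by (simp_all add: uq_module_def)
  show ?thesis
    using assms(2,3) Uq_closed(1) [of q]
    by (intro ext) (simp add: equitable_nil_def uq_module_minus [OF assms(1)] mult scalar one)
qed

text \<open>For the primary identification \<open>y\<close> acts as \<open>k\<close> itself; for the secondary one the same lemma is
  applied after the Chevalley involution.\<close>

lemma uq_module_equitable:
  fixes \<theta> :: "'f::field"
  assumes mod: "uq_module scale q \<rho>" and "type1 scale q \<rho>" and "not_root_of_unity q" and "\<theta> \<noteq> 0"
  shows "\<exists>Yi. equitable_action scale q (\<rho> (eq_y idt q \<theta> t)) (\<rho> (eq_x idt q \<theta> t)) Yi (\<rho> (eq_z idt q \<theta> t))"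
proof -
  interpret U: ring "Uq q" by (rule Uq_ring)
  interpret C: chevalley_action scale q "\<lambda>m. \<rho> (uq_kpow q m)" "\<rho> (uq_e q)" "\<rho> (uq_f q)"
    by (rule uq_module_chevalley_action [OF assms(1-3)])
  interpret D: chevalley_action scale q "\<lambda>m. \<rho> (uq_kpow q (- m))" "\<rho> (uq_f q)" "\<rho> (uq_e q)"
    by (rule C.chevalley_involution)
  have add: "a \<in> carrier (Uq q) \<Longrightarrow> b \<in> carrier (Uq q) \<Longrightarrow> \<rho> (a \<oplus>\<^bsub>Uq q\<^esub> b) v = \<rho> a v + \<rho> b v"
    and mult: "a \<in> carrier (Uq q) \<Longrightarrow> b \<in> carrier (Uq q) \<Longrightarrow> \<rho> (a \<otimes>\<^bsub>Uq q\<^esub> b) v = \<rho> a (\<rho> b v)"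
    and scalar: "\<rho> (uq_scalar q c) v = scale c v" for a b v c
    using mod by (simp_all add: uq_module_def)
  note simps = add mult scalar uq_module_minus [OF mod] Uq_closed uq_kpow_closed uq_kpow_1
    add.commute [of 1 t]
  show ?thesis
  proof (cases idt)
    case Primary
    have "\<rho> (eq_x idt q \<theta> t) = C.equitable_x \<theta> t" "\<rho> (eq_z idt q \<theta> t) = C.equitable_z \<theta> t"
      "\<rho> (eq_y idt q \<theta> t) = \<rho> (uq_kpow q 1)"
      by (simp_all add: fun_eq_iff Primary C.equitable_x_def C.equitable_z_def simps)
    then show ?thesis
      using C.equitable_action_chevalley [OF assms(4), of t] by auto
  next
    case Secondary
    have "\<rho> (eq_x idt q \<theta> t) = D.equitable_x \<theta> t" "\<rho> (eq_z idt q \<theta> t) = D.equitable_z \<theta> t"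
      "\<rho> (eq_y idt q \<theta> t) = \<rho> (uq_kpow q (- 1))"
      by (simp_all add: fun_eq_iff Secondary D.equitable_x_def D.equitable_z_def simps)
    then show ?thesis
      using D.equitable_action_chevalley [OF assms(4), of t] by auto
  qed
qed

text \<open>\<open>\<Upsilon>\<close> is defined through the weights of \<open>k\<close> but is used through those of \<open>y\<close>. For the secondary
  identification the latter are the negatives of the former, and the squares agree.\<close>

lemma uq_module_Upsilon:
  assumes mod: "uq_module scale q \<rho>" and "type1 scale q \<rho>" and "not_root_of_unity q"
  shows "Vector_Spaces.linear scale scale (Upsilon scale q \<rho> s)"
    and "\<rho> (eq_y idt q \<theta> t) v = scale (q powi \<mu>) v \<Longrightarrow> Upsilon scale q \<rho> s v = scale (s powi (- (\<mu> ^ 2))) v"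
proof -
  interpret C: chevalley_action scale q "\<lambda>m. \<rho> (uq_kpow q m)" "\<rho> (uq_e q)" "\<rho> (uq_f q)"
    by (rule uq_module_chevalley_action [OF assms])
  interpret D: chevalley_action scale q "\<lambda>m. \<rho> (uq_kpow q (- m))" "\<rho> (uq_f q)" "\<rho> (uq_e q)"
    by (rule C.chevalley_involution)
  have k: "\<rho> (uq_k q) = \<rho> (uq_kpow q 1)"
    by (simp add: uq_kpow_1)
  show "Vector_Spaces.linear scale scale (Upsilon scale q \<rho> s)"
    by (rule C.Upsilon_weight(1) [where \<rho> = \<rho>, OF k])
  show "Upsilon scale q \<rho> s v = scale (s powi (- (\<mu> ^ 2))) v"
    if v: "\<rho> (eq_y idt q \<theta> t) v = scale (q powi \<mu>) v"
  proof (cases idt)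
    case Primary
    then show ?thesis
      using v C.Upsilon_weight(2) [where \<rho> = \<rho>, OF k, of v \<mu> s] by (simp add: k)
  next
    case Secondary
    then have "\<rho> (uq_kpow q 1) v = scale (q powi (- \<mu>)) v"
      using v D.K_weight [of v \<mu> "- 1"] by simp
    then show ?thesis
      using C.Upsilon_weight(2) [where \<rho> = \<rho>, OF k, of v "- \<mu>" s] by simp
  qed
qed

theorem lemma9p8:
  fixes q \<theta> :: "'f::field" and t :: int and idt :: identification
    and scale :: "'f \<Rightarrow> 'v::ab_group_add \<Rightarrow> 'v"
    and \<rho> :: "'f uq \<Rightarrow> 'v \<Rightarrow> 'v"
  assumes "q \<noteq> 0"
    and "\<And>n::nat. n \<ge> 1 \<Longrightarrow> q ^ n \<noteq> 1"
    and "\<exists>r. r^2 = q"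
    and "\<theta>^2 = q \<or> \<theta>^2 = inverse q"
    and "uq_module scale q \<rho>"
    and "finite_dim scale"
    and "type1 scale q \<rho>"
  shows "is_rotator scale q \<rho> idt \<theta> t (rotator_op scale q \<rho> idt \<theta> t)"
proof -
  let ?X = "\<rho> (eq_x idt q \<theta> t)" and ?Y = "\<rho> (eq_y idt q \<theta> t)" and ?Z = "\<rho> (eq_z idt q \<theta> t)"
  let ?s = "sqrt_q q \<theta>"
  let ?T = "Upsilon scale q \<rho> ?s"
  have q: "not_root_of_unity q"
    by unfold_locales (fact assms(1) assms(2))+
  have "\<theta> \<noteq> 0"
    using assms(1,4) by auto
  then obtain Yi where "equitable_action scale q ?Y ?X Yi ?Z"
    using uq_module_equitable [OF assms(5,7) q] by blast
  then interpret equitable_action scale q ?Y ?X Yi ?Z .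
  \<comment> \<open>The sign in the definition of the square root is lost by squaring; both cases lead to \<open>q\<close>.\<close>
  have s: "?s ^ 2 = q"
    using assms(4) by (auto simp: sqrt_q_def power_inverse)
  note T = uq_module_Upsilon [OF assms(5,7) q]
  note rot = T(1) [of ?s] T(2) [where s = ?s and idt = idt and \<theta> = \<theta> and t = t]
  define R where "R = F \<circ> ?T \<circ> E"
  have R: "rotator_op scale q \<rho> idt \<theta> t = R"
    unfolding rotator_op_def R_def uq_nx_def uq_nz_def
    by (simp add: uq_module_equitable_nil [OF assms(5)] eq_closed)
  have lin: "Vector_Spaces.linear scale scale R"
    unfolding R_def by (rule linear_rotator [OF s rot])
  have bij: "bij R"
    unfolding R_def by (rule bij_rotator [OF s rot])
  have conj: "inv_into UNIV R \<circ> S \<circ> R = S'" if "\<And>v. S (R v) = R (S' v)" for S S'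
    using that bij by (simp add: fun_eq_iff inv_f_f bij_is_inj)
  show ?thesis
    unfolding is_rotator_def R
    by (intro conjI lin bij conj; simp add: R_def rotator_X [OF s rot] rotator_Y [OF s rot] rotator_Z [OF s rot])
qed

end
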